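(* Let $\mathbf{k}$ be an algebraically closed field of characteristic $0$. Let $(V,c)$ be a $3$-dimensional braided pair of group type. Then either \begin{itemize} \item $(V,c)$ is of abelian group type, or \item $(V,c)\simeq V_{3,q}$ for some $q\in\mathbf{k}^\times$. \end{itemize} Consequently, if $\Gamma$ is a finite group and $V$ is a $3$-dimensional (left-left) Yetter--Drinfeld module over $\mathbf{k}\Gamma$ with braiding $c$, then $V$ has a basis $\{x_0,x_1,x_2\}$ such that either \begin{itemize} \item $c(x_i\otimes x_j)=q_{ij}x_j\otimes x_i$ for all $i,j$, for some roots of unity $q_{ij}$, or \item $c(x_i\otimes x_j)=q\,x_{-i-j}\otimes x_i$ for all $i,j$ (subindices in $\mathbb{Z}/3$), for some root of unity $q$. \end{itemize}
   Context: A braided pair (BP) is a pair $(V,c)$ with $V$ a vector space and $c:V\otimes V\to V\otimes V$ a bijective solution of the braid equation. $(V,c)$ is of group type if $V$ has a basis $\{y_1,\dots,y_n\}$ and there are $g_i\in\mathrm{GL}(V)$ with $c(y_i\otimes y_j)=g_i(y_j)\otimes y_i$ for all $i,j$; it is of abelian group type if moreover (for some such basis) the group generated by $g_1,\dots,g_n$ is abelian. For $q\in\mathbf{k}^\times$, $V_{3,q}$ denotes the braided pair with basis $\{x_0,x_1,x_2\}$ (subindices in $\mathbb{Z}/3$) and braiding $c(x_i\otimes x_j)=q\,x_{-i-j}\otimes x_i$. A Yetter--Drinfeld module $V$ over $\mathbf{k}\Gamma$ with coaction $\delta(v)=v_{(-1)}\otimes v_{(0)}$ has the braiding $c(v\otimes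 w)=v_{(-1)}\cdot w\otimes v_{(0)}$. *)

theory Defs
  imports
    "HOL-Algebra.Elementary_Groups"
    "HOL-Algebra.Bij"
    "HOL-Computational_Algebra.Polynomial"
    "HOL-Library.Function_Algebras"
    "HOL-Library.Numeral_Type"
begin

section \<open>Vector spaces and tensor products\<close>

text \<open>
  A vector space is a subspace (the carrier) of a type carrying a scalar multiplication.
  Carriers are needed because a tensor product is a proper subset of its ambient function type.
\<close>

record ('k, 'a) vec_space = "'a partial_object" +
  scl :: "'k \<Rightarrow> 'a \<Rightarrow> 'a"

definition is_vec_space :: "('k::field, 'a::ab_group_add) vec_space \<Rightarrow> bool" where
  "is_vec_space V \<longleftrightarrow> vector_space (scl V) \<and> module.subspace (scl V) (carrier V)"

definition base_field :: "('k::field, 'k) vec_space" where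
  "base_field = \<lparr>carrier = UNIV, scl = (*)\<rparr>"

definition fscale :: "'k::field \<Rightarrow> ('x \<Rightarrow> 'k) \<Rightarrow> 'x \<Rightarrow> 'k" where
  "fscale r f = (\<lambda>x. r * f x)"

definition lin_map ::
  "('k::field, 'a::ab_group_add) vec_space \<Rightarrow> ('k, 'b::ab_group_add) vec_space \<Rightarrow> ('a \<Rightarrow> 'b) \<Rightarrow> bool"
  where
  "lin_map V W f \<longleftrightarrow>
     (\<forall>x\<in>carrier V. f x \<in> carrier W) \<and>
     (\<forall>x\<in>carrier V. \<forall>y\<in>carrier V. f (x + y) = f x + f y) \<and>
     (\<forall>r. \<forall>x\<in>carrier V. f (scl V r x) = scl W r (f x))"

definition bilin_map ::
  "('k::field, 'a::ab_group_add) vec_space \<Rightarrow> ('k, 'b::ab_group_add) vec_space \<Rightarrow>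
   ('k, 'c::ab_group_add) vec_space \<Rightarrow> ('a \<Rightarrow> 'b \<Rightarrow> 'c) \<Rightarrow> bool" where
  "bilin_map V W U \<beta> \<longleftrightarrow>
     (\<forall>v\<in>carrier V. lin_map W U (\<beta> v)) \<and> (\<forall>w\<in>carrier W. lin_map V U (\<lambda>v. \<beta> v w))"

text \<open>
  The tensor product is realised inside the dual of the space of bilinear forms: the pure tensor of
  \<open>v\<close> and \<open>w\<close> is evaluation of bilinear forms at \<open>(v, w)\<close>, and the tensor product is the span of
  the pure tensors. The universal property is proved below.
\<close>

type_synonym ('k, 'a, 'b) tensor = "('a \<Rightarrow> 'b \<Rightarrow> 'k) \<Rightarrow> 'k"

definition tens ::
  "('k::field, 'a::ab_group_add) vec_space \<Rightarrow> ('k, 'b::ab_group_add) vec_space \<Rightarrow>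
   'a \<Rightarrow> 'b \<Rightarrow> ('k, 'a, 'b) tensor" where
  "tens V W v w = (\<lambda>\<beta>. if bilin_map V W base_field \<beta> then \<beta> v w else 0)"

definition tensor_prod ::
  "('k::field, 'a::ab_group_add) vec_space \<Rightarrow> ('k, 'b::ab_group_add) vec_space \<Rightarrow>
   ('k, ('k, 'a, 'b) tensor) vec_space" (infixr "\<otimes>\<^sub>V" 70) where
  "V \<otimes>\<^sub>V W = \<lparr>carrier = module.span fscale {tens V W v w |v w. v \<in> carrier V \<and> w \<in> carrier W},
            scl = fscale\<rparr>"

text \<open>
  The linear map induced by a bilinear map \<open>\<beta>\<close>; it is determined on the carrier of \<open>V \<otimes>\<^sub>V W\<close>.
\<close>

definition tensor_lift ::
  "('k::field, 'a::ab_group_add) vec_space \<Rightarrow> ('k, 'b::ab_group_add) vec_space \<Rightarrow>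
   ('k, 'c::ab_group_add) vec_space \<Rightarrow> ('a \<Rightarrow> 'b \<Rightarrow> 'c) \<Rightarrow> ('k, 'a, 'b) tensor \<Rightarrow> 'c" where
  "tensor_lift V W U \<beta> = (SOME h. lin_map (V \<otimes>\<^sub>V W) U h \<and>
     (\<forall>v\<in>carrier V. \<forall>w\<in>carrier W. h (tens V W v w) = \<beta> v w))"

lemma vector_space_fscale: "vector_space fscale"
  by unfold_locales (simp_all add: fscale_def fun_eq_iff algebra_simps)

lemma is_vec_space_tensor_prod: "is_vec_space (V \<otimes>\<^sub>V W)"
proof -
  interpret F: vector_space fscale by (rule vector_space_fscale)
  show ?thesis
    by (simp add: is_vec_space_def tensor_prod_def vector_space_fscale F.subspace_span)
qed


lemma is_vec_space_base_field: "is_vec_space base_field"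
proof -
  interpret vector_space "(*) :: 'a \<Rightarrow> 'a \<Rightarrow> 'a"
    by unfold_locales (simp_all add: algebra_simps)
  show ?thesis
    by (simp add: is_vec_space_def base_field_def vector_space_axioms)
qed

lemma tens_in_carrier:
  "v \<in> carrier V \<Longrightarrow> w \<in> carrier W \<Longrightarrow> tens V W v w \<in> carrier (V \<otimes>\<^sub>V W)"
proof -
  interpret F: vector_space fscale by (rule vector_space_fscale)
  show "v \<in> carrier V \<Longrightarrow> w \<in> carrier W \<Longrightarrow> ?thesis"
    by (auto simp: tensor_prod_def intro!: F.span_base)
qed

lemma bilin_map_tens: "bilin_map V W (V \<otimes>\<^sub>V W) (tens V W)"
proof -
  have s: "scl (V \<otimes>\<^sub>V W) = fscale" by (simp add: tensor_prod_def)
  show ?thesis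
    unfolding bilin_map_def lin_map_def
    by (auto simp: tens_in_carrier s)
       (auto simp: tens_def fun_eq_iff fscale_def bilin_map_def lin_map_def base_field_def)
qed

lemma tensor_prod_induct [consumes 1, case_names tens zero add scale]:
  assumes "t \<in> carrier (V \<otimes>\<^sub>V W)"
    and "\<And>v w. v \<in> carrier V \<Longrightarrow> w \<in> carrier W \<Longrightarrow> P (tens V W v w)"
    and "P 0"
    and "\<And>s t. s \<in> carrier (V \<otimes>\<^sub>V W) \<Longrightarrow> t \<in> carrier (V \<otimes>\<^sub>V W) \<Longrightarrow> P s \<Longrightarrow> P t \<Longrightarrow> P (s + t)"
    and "\<And>r t. t \<in> carrier (V \<otimes>\<^sub>V W) \<Longrightarrow> P t \<Longrightarrow> P (scl (V \<otimes>\<^sub>V W) r t)"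
  shows "P t"
proof -
  interpret F: vector_space fscale by (rule vector_space_fscale)
  let ?S = "{tens V W v w |v w. v \<in> carrier V \<and> w \<in> carrier W}"
  have "F.subspace {t \<in> carrier (V \<otimes>\<^sub>V W). P t}"
    using assms(3-5) unfolding F.subspace_def
    by (auto simp: tensor_prod_def F.span_zero intro: F.span_add F.span_scale)
  moreover have "?S \<subseteq> {t \<in> carrier (V \<otimes>\<^sub>V W). P t}"
    using assms(2) tens_in_carrier by blast
  ultimately have "F.span ?S \<subseteq> {t \<in> carrier (V \<otimes>\<^sub>V W). P t}"
    by (rule F.span_minimal[rotated])
  with assms(1) show ?thesis by (auto simp: tensor_prod_def)
qed

lemma lin_map_zero:
  assumes "is_vec_space V" "is_vec_space W" "lin_map V W f"
  shows "f 0 = 0"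
proof -
  interpret v: vector_space "scl V" using assms by (simp add: is_vec_space_def)
  interpret w: vector_space "scl W" using assms by (simp add: is_vec_space_def)
  have "0 \<in> carrier V" using assms v.subspace_0 by (auto simp: is_vec_space_def)
  then have "f (scl V 0 0) = scl W 0 (f 0)" using assms(3) unfolding lin_map_def by blast
  then show ?thesis by simp
qed

lemma lin_map_sum:
  assumes "is_vec_space V" "is_vec_space W" "lin_map V W f" "finite A" "A \<subseteq> carrier V"
  shows "f (\<Sum>a\<in>A. scl V (r a) a) = (\<Sum>a\<in>A. scl W (r a) (f a))"
proof -
  interpret v: vector_space "scl V" using assms by (simp add: is_vec_space_def)
  have sub: "v.subspace (carrier V)" using assms by (simp add: is_vec_space_def)
  show ?thesis using assms(4,5)
  proof (induction A)
    case empty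
    then show ?case by (simp add: lin_map_zero[OF assms(1-3)])
  next
    case (insert x F)
    have "(\<Sum>a\<in>F. scl V (r a) a) \<in> carrier V"
      using insert.prems by (intro v.subspace_sum[OF sub] v.subspace_scale[OF sub]) auto
    moreover have "scl V (r x) x \<in> carrier V"
      using insert.prems by (intro v.subspace_scale[OF sub]) auto
    ultimately show ?case
      using insert assms(3) by (simp add: lin_map_def)
  qed
qed

lemma lin_map_tensor_unique:
  assumes U: "is_vec_space U" and f: "lin_map (V \<otimes>\<^sub>V W) U f" and g: "lin_map (V \<otimes>\<^sub>V W) U g"
    and eq: "\<And>v w. v \<in> carrier V \<Longrightarrow> w \<in> carrier W \<Longrightarrow> f (tens V W v w) = g (tens V W v w)"
    and t: "t \<in> carrier (V \<otimes>\<^sub>V W)"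
  shows "f t = g t"
  using t
proof (induction rule: tensor_prod_induct)
  case (tens v w)
  then show ?case by (rule eq)
next
  case zero
  show ?case using lin_map_zero[OF is_vec_space_tensor_prod U] f g by metis
next
  case (add s t)
  then have "f (s + t) = f s + f t" "g (s + t) = g s + g t"
    using f g unfolding lin_map_def by blast+
  with add show ?case by metis
next
  case (scale r t)
  then show ?case using f g unfolding lin_map_def by metis
qed

lemma tensor_lift_exists:
  assumes V: "is_vec_space V" and W: "is_vec_space W" and U: "is_vec_space U"
    and b: "bilin_map V W U \<beta>"
  shows "\<exists>h. lin_map (V \<otimes>\<^sub>V W) U h \<and>
    (\<forall>v\<in>carrier V. \<forall>w\<in>carrier W. h (tens V W v w) = \<beta> v w)"
proof -
  interpret v: vector_space "scl V" using V by (simp add: is_vec_space_def)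
  interpret w: vector_space "scl W" using W by (simp add: is_vec_space_def)
  interpret u: vector_space "scl U" using U by (simp add: is_vec_space_def)
  have sv: "v.subspace (carrier V)" and sw: "w.subspace (carrier W)" and su: "u.subspace (carrier U)"
    using V W U by (simp_all add: is_vec_space_def)
  obtain A where A: "A \<subseteq> carrier V" "v.independent A" "carrier V \<subseteq> v.span A"
    by (rule v.maximal_independent_subset)
  obtain B where B: "B \<subseteq> carrier W" "w.independent B" "carrier W \<subseteq> w.span B"
    by (rule w.maximal_independent_subset)
  define \<phi> where "\<phi> = (\<lambda>(a, b) x y. v.representation A x a * w.representation B y b)"
  have \<phi>: "bilin_map V W base_field (\<phi> p)" for p
    using A B unfolding bilin_map_def lin_map_def \<phi>_def
    by (auto simp: base_field_def v.representation_add w.representation_add subset_iff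
        v.representation_scale w.representation_scale algebra_simps split: prod.splits)
  define supp where "supp t = {p. t (\<phi> p) \<noteq> 0}" for t :: "('b, 'a, 'c) tensor"
  define h where "h t = (\<Sum>p\<in>supp t. scl U (t (\<phi> p)) (\<beta> (fst p) (snd p)))" for t
  have tphi: "tens V W x y (\<phi> p) = v.representation A x (fst p) * w.representation B y (snd p)" for x y p
    by (simp add: tens_def \<phi>) (simp add: \<phi>_def case_prod_beta)
  have scs: "scl (V \<otimes>\<^sub>V W) = fscale" by (simp add: tensor_prod_def)
  have fin: "finite (supp t) \<and> supp t \<subseteq> A \<times> B" if "t \<in> carrier (V \<otimes>\<^sub>V W)" for t
    using that
  proof (induction rule: tensor_prod_induct)
    case (tens x y)
    have "supp (tens V W x y) =
        {a. v.representation A x a \<noteq> 0} \<times> {b. w.representation B y b \<noteq> 0}"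
      by (auto simp: supp_def tphi)
    then show ?case
      using v.finite_representation w.finite_representation v.representation_ne_zero
        w.representation_ne_zero by (auto intro!: finite_cartesian_product)
  next
    case zero
    then show ?case by (simp add: supp_def)
  next
    case (add s t)
    have "supp (s + t) \<subseteq> supp s \<union> supp t" by (auto simp: supp_def)
    with add show ?case by (meson finite_Un finite_subset le_sup_iff order_trans Un_least)
  next
    case (scale r t)
    have "supp (fscale r t) \<subseteq> supp t" by (auto simp: supp_def fscale_def)
    with scale show ?case unfolding scs by (meson finite_subset order_trans)
  qed
  have hsup: "h t = (\<Sum>p\<in>S. scl U (t (\<phi> p)) (\<beta> (fst p) (snd p)))"
    if "finite S" "supp t \<subseteq> S" for t S
    unfolding h_def using that by (intro sum.mono_neutral_left) (auto simp: supp_def)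
  have bcar: "\<beta> a b \<in> carrier U" if "a \<in> carrier V" "b \<in> carrier W" for a b
    using b that by (auto simp: bilin_map_def lin_map_def)
  have "lin_map (V \<otimes>\<^sub>V W) U h"
    unfolding lin_map_def
  proof (intro conjI ballI allI)
    fix t assume t: "t \<in> carrier (V \<otimes>\<^sub>V W)"
    show "h t \<in> carrier U"
      unfolding h_def using fin[OF t] A(1) B(1)
      by (intro u.subspace_sum[OF su] u.subspace_scale[OF su] bcar) auto
    fix r
    have "supp (fscale r t) \<subseteq> supp t" by (auto simp: supp_def fscale_def)
    then have "h (fscale r t) = (\<Sum>p\<in>supp t. scl U (fscale r t (\<phi> p)) (\<beta> (fst p) (snd p)))"
      using fin[OF t] by (intro hsup) auto
    then show "h (scl (V \<otimes>\<^sub>V W) r t) = scl U r (h t)"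
      by (simp add: scs h_def u.scale_sum_right) (simp add: fscale_def)
  next
    fix s t assume s: "s \<in> carrier (V \<otimes>\<^sub>V W)" and t: "t \<in> carrier (V \<otimes>\<^sub>V W)"
    let ?S = "supp s \<union> supp t"
    have f: "finite ?S" using fin s t by auto
    have "h (s + t) = (\<Sum>p\<in>?S. scl U ((s + t) (\<phi> p)) (\<beta> (fst p) (snd p)))"
      using f by (intro hsup) (auto simp: supp_def)
    also have "\<dots> = h s + h t"
      using f by (simp add: hsup[of ?S] u.scale_left_distrib sum.distrib)
    finally show "h (s + t) = h s + h t" .
  qed
  moreover have "h (tens V W x y) = \<beta> x y" if x: "x \<in> carrier V" and y: "y \<in> carrier W" for x y
  proof -
    let ?P = "{a. v.representation A x a \<noteq> 0}" and ?Q = "{b. w.representation B y b \<noteq> 0}"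
    have P: "finite ?P" "?P \<subseteq> carrier V" and Q: "finite ?Q" "?Q \<subseteq> carrier W"
      using v.finite_representation w.finite_representation v.representation_ne_zero
        w.representation_ne_zero A(1) B(1) by blast+
    have ex: "(\<Sum>a\<in>?P. scl V (v.representation A x a) a) = x"
      using A x by (intro v.sum_nonzero_representation_eq) auto
    have ey: "(\<Sum>b\<in>?Q. scl W (w.representation B y b) b) = y"
      using B y by (intro w.sum_nonzero_representation_eq) auto
    have "h (tens V W x y) = (\<Sum>p\<in>?P \<times> ?Q. scl U (tens V W x y (\<phi> p)) (\<beta> (fst p) (snd p)))"
      using P Q by (intro hsup) (auto simp: supp_def tphi)
    also have "\<dots> = (\<Sum>a\<in>?P. \<Sum>b\<in>?Q.
        scl U (v.representation A x a * w.representation B y b) (\<beta> a b))"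
      by (simp add: sum.cartesian_product tphi case_prod_beta)
    also have "\<dots> = (\<Sum>a\<in>?P. scl U (v.representation A x a)
        (\<Sum>b\<in>?Q. scl U (w.representation B y b) (\<beta> a b)))"
      by (simp add: u.scale_sum_right)
    also have "\<dots> = (\<Sum>a\<in>?P. scl U (v.representation A x a) (\<beta> a y))"
    proof (intro sum.cong refl)
      fix a assume "a \<in> ?P"
      then have "lin_map W U (\<beta> a)" using P b by (auto simp: bilin_map_def)
      from lin_map_sum[OF W U this Q, of "w.representation B y"]
      show "scl U (v.representation A x a) (\<Sum>b\<in>?Q. scl U (w.representation B y b) (\<beta> a b))
          = scl U (v.representation A x a) (\<beta> a y)" by (simp add: ey)
    qed
    also have "\<dots> = \<beta> x y"
    proof -
      have "lin_map V U (\<lambda>v. \<beta> v y)" using y b by (auto simp: bilin_map_def)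
      from lin_map_sum[OF V U this P, of "v.representation A x"] show ?thesis by (simp add: ex)
    qed
    finally show ?thesis .
  qed
  ultimately show ?thesis by blast
qed

lemma tensor_lift:
  assumes "is_vec_space V" "is_vec_space W" "is_vec_space U" "bilin_map V W U \<beta>"
  shows lin_map_tensor_lift: "lin_map (V \<otimes>\<^sub>V W) U (tensor_lift V W U \<beta>)"
    and tensor_lift_tens: "v \<in> carrier V \<Longrightarrow> w \<in> carrier W \<Longrightarrow>
      tensor_lift V W U \<beta> (tens V W v w) = \<beta> v w"
  using someI_ex[OF tensor_lift_exists[OF assms]] unfolding tensor_lift_def by blast+

definition tensor_map ::
  "('k::field, 'a::ab_group_add) vec_space \<Rightarrow> ('k, 'b::ab_group_add) vec_space \<Rightarrow>
   ('k, 'c::ab_group_add) vec_space \<Rightarrow> ('k, 'd::ab_group_add) vec_space \<Rightarrow>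
   ('a \<Rightarrow> 'c) \<Rightarrow> ('b \<Rightarrow> 'd) \<Rightarrow> ('k, 'a, 'b) tensor \<Rightarrow> ('k, 'c, 'd) tensor" where
  "tensor_map V W V' W' f g = tensor_lift V W (V' \<otimes>\<^sub>V W') (\<lambda>v w. tens V' W' (f v) (g w))"

text \<open>The associator \<open>(u \<otimes> v) \<otimes> w \<mapsto> u \<otimes> (v \<otimes> w)\<close>.\<close>

definition assoc_map ::
  "('k::field, 'a::ab_group_add) vec_space \<Rightarrow> ('k, 'b::ab_group_add) vec_space \<Rightarrow>
   ('k, 'c::ab_group_add) vec_space \<Rightarrow>
   ('k, ('k, 'a, 'b) tensor, 'c) tensor \<Rightarrow> ('k, 'a, ('k, 'b, 'c) tensor) tensor" where
  "assoc_map U V W = tensor_lift (U \<otimes>\<^sub>V V) W (U \<otimes>\<^sub>V (V \<otimes>\<^sub>V W))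
     (\<lambda>t w. tensor_lift U V (U \<otimes>\<^sub>V (V \<otimes>\<^sub>V W)) (\<lambda>u v. tens U (V \<otimes>\<^sub>V W) u (tens V W v w)) t)"

section \<open>Braided pairs\<close>

definition braid_equation ::
  "('k::field, 'v::ab_group_add) vec_space \<Rightarrow> (('k, 'v, 'v) tensor \<Rightarrow> ('k, 'v, 'v) tensor) \<Rightarrow> bool"
  where
  "braid_equation V c \<longleftrightarrow>
     (let VVV = (V \<otimes>\<^sub>V V) \<otimes>\<^sub>V V;
          \<alpha> = assoc_map V V V;
          c1 = tensor_map (V \<otimes>\<^sub>V V) V (V \<otimes>\<^sub>V V) V c id;
          c2 = (\<lambda>t. inv_into (carrier VVV) \<alpha> (tensor_map V (V \<otimes>\<^sub>V V) V (V \<otimes>\<^sub>V V) id c (\<alpha> t)))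
      in \<forall>t\<in>carrier VVV. c1 (c2 (c1 t)) = c2 (c1 (c2 t)))"

definition braided_pair ::
  "('k::field, 'v::ab_group_add) vec_space \<Rightarrow> (('k, 'v, 'v) tensor \<Rightarrow> ('k, 'v, 'v) tensor) \<Rightarrow> bool"
  where
  "braided_pair V c \<longleftrightarrow> is_vec_space V \<and> lin_map (V \<otimes>\<^sub>V V) (V \<otimes>\<^sub>V V) c \<and>
     bij_betw c (carrier (V \<otimes>\<^sub>V V)) (carrier (V \<otimes>\<^sub>V V)) \<and> braid_equation V c"

definition braided_iso ::
  "('k::field, 'v::ab_group_add) vec_space \<Rightarrow> (('k, 'v, 'v) tensor \<Rightarrow> ('k, 'v, 'v) tensor) \<Rightarrow>
   ('k, 'w::ab_group_add) vec_space \<Rightarrow> (('k, 'w, 'w) tensor \<Rightarrow> ('k, 'w, 'w) tensor) \<Rightarrow> bool"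
  where
  "braided_iso V c W d \<longleftrightarrow>
     (\<exists>\<phi>. lin_map V W \<phi> \<and> bij_betw \<phi> (carrier V) (carrier W) \<and>
       (\<forall>t\<in>carrier (V \<otimes>\<^sub>V V).
          tensor_map V V W W \<phi> \<phi> (c t) = d (tensor_map V V W W \<phi> \<phi> t)))"

definition basis_family :: "('k::field, 'v::ab_group_add) vec_space \<Rightarrow> 'i set \<Rightarrow> ('i \<Rightarrow> 'v) \<Rightarrow> bool"
  where
  "basis_family V I y \<longleftrightarrow> inj_on y I \<and> \<not> module.dependent (scl V) (y ` I) \<and>
     module.span (scl V) (y ` I) = carrier V"

definition GL :: "('k::field, 'v::ab_group_add) vec_space \<Rightarrow> ('v \<Rightarrow> 'v) monoid" where
  "GL V = BijGroup (carrier V)\<lparr>carrier := {f \<in> Bij (carrier V). lin_map V V f}\<rparr>"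

definition group_type_basis ::
  "('k::field, 'v::ab_group_add) vec_space \<Rightarrow> (('k, 'v, 'v) tensor \<Rightarrow> ('k, 'v, 'v) tensor) \<Rightarrow>
   nat \<Rightarrow> (nat \<Rightarrow> 'v) \<Rightarrow> (nat \<Rightarrow> 'v \<Rightarrow> 'v) \<Rightarrow> bool" where
  "group_type_basis V c n y g \<longleftrightarrow> basis_family V {1..n} y \<and> (\<forall>i\<in>{1..n}. g i \<in> carrier (GL V)) \<and>
     (\<forall>i\<in>{1..n}. \<forall>j\<in>{1..n}. c (tens V V (y i) (y j)) = tens V V (g i (y j)) (y i))"

definition group_type ::
  "('k::field, 'v::ab_group_add) vec_space \<Rightarrow> (('k, 'v, 'v) tensor \<Rightarrow> ('k, 'v, 'v) tensor) \<Rightarrow> bool"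
  where
  "group_type V c \<longleftrightarrow> (\<exists>n y g. group_type_basis V c n y g)"

definition abelian_group_type ::
  "('k::field, 'v::ab_group_add) vec_space \<Rightarrow> (('k, 'v, 'v) tensor \<Rightarrow> ('k, 'v, 'v) tensor) \<Rightarrow> bool"
  where
  "abelian_group_type V c \<longleftrightarrow>
     (\<exists>n y g. group_type_basis V c n y g \<and> comm_group (subgroup_generated (GL V) (g ` {1..n})))"

text \<open>
  The braided pair \<open>V\<^sub>3\<^sub>,\<^sub>q\<close>, on the space of functions \<open>\<int>/3 \<rightarrow> k\<close>. The numeral type \<open>3\<close> carries
  arithmetic modulo 3.
\<close>

definition V3_space :: "('k::field, 3 \<Rightarrow> 'k) vec_space" where
  "V3_space = \<lparr>carrier = UNIV, scl = fscale\<rparr>"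

definition V3_basis :: "3 \<Rightarrow> 3 \<Rightarrow> 'k::field" where
  "V3_basis i = (\<lambda>j. if j = i then 1 else 0)"

definition V3_braiding :: "'k::field \<Rightarrow> ('k, 3 \<Rightarrow> 'k, 3 \<Rightarrow> 'k) tensor \<Rightarrow> ('k, 3 \<Rightarrow> 'k, 3 \<Rightarrow> 'k) tensor"
  where
  "V3_braiding q = tensor_lift V3_space V3_space (V3_space \<otimes>\<^sub>V V3_space)
     (\<lambda>v w. \<Sum>i\<in>UNIV. \<Sum>j\<in>UNIV.
        fscale (v i * w j * q) (tens V3_space V3_space (V3_basis (- i - j)) (V3_basis i)))"

lemma V3_braiding_basis:
  "V3_braiding q (tens V3_space V3_space (V3_basis i) (V3_basis j)) =
   scl (V3_space \<otimes>\<^sub>V V3_space) q (tens V3_space V3_space (V3_basis (- i - j)) (V3_basis i))"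
proof -
  let ?S = "V3_space :: ('a, 3 \<Rightarrow> 'a) vec_space"
  let ?T = "\<lambda>i j. tens ?S ?S (V3_basis (- i - j)) (V3_basis i)"
  let ?\<beta> = "\<lambda>v w. \<Sum>i\<in>UNIV. \<Sum>j\<in>UNIV. fscale (v i * w j * q) (?T i j)"
  have V: "is_vec_space ?S"
    by (simp add: is_vec_space_def V3_space_def vector_space_fscale
        module.subspace_UNIV[OF vector_space_fscale[folded module_iff_vector_space]])
  have c: "carrier ?S = UNIV" "scl ?S = fscale" by (simp_all add: V3_space_def)
  have TT: "is_vec_space (?S \<otimes>\<^sub>V ?S)" by (rule is_vec_space_tensor_prod)
  have s: "scl (?S \<otimes>\<^sub>V ?S) = fscale" by (simp add: tensor_prod_def)
  have sub: "module.subspace fscale (carrier (?S \<otimes>\<^sub>V ?S))"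
    using TT by (simp add: is_vec_space_def s)
  interpret G: vector_space "fscale :: 'a \<Rightarrow> ('a, 3 \<Rightarrow> 'a, 3 \<Rightarrow> 'a) tensor \<Rightarrow> _"
    by (rule vector_space_fscale)
  have "?\<beta> v w \<in> carrier (?S \<otimes>\<^sub>V ?S)" for v w
    by (intro G.subspace_sum[OF sub] G.subspace_scale[OF sub] tens_in_carrier) (simp_all add: c)
  then have "bilin_map ?S ?S (?S \<otimes>\<^sub>V ?S) ?\<beta>"
    unfolding bilin_map_def lin_map_def c s
    by (simp add: G.scale_sum_right sum.distrib[symmetric] G.scale_left_distrib[symmetric]
        distrib_left distrib_right) (simp add: fscale_def ac_simps)
  from tensor_lift_tens[OF V V TT this, of "V3_basis i" "V3_basis j"]
  have "V3_braiding q (tens ?S ?S (V3_basis i) (V3_basis j)) = ?\<beta> (V3_basis i) (V3_basis j)"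
    by (simp add: c V3_braiding_def)
  also have "\<dots> = (\<Sum>k\<in>UNIV. \<Sum>l\<in>UNIV. if l = j then (if k = i then fscale q (?T k l) else 0) else 0)"
    by (intro sum.cong refl) (auto simp: V3_basis_def)
  also have "\<dots> = fscale q (?T i j)"
    by simp
  finally show ?thesis by (simp add: s)
qed

section \<open>Yetter--Drinfeld modules over a finite group\<close>

text \<open>
  The group algebra of a finite group \<open>G\<close> consists of the functions vanishing outside \<open>carrier G\<close>,
  with its usual Hopf algebra structure.
\<close>

definition group_algebra :: "('g, 'm) monoid_scheme \<Rightarrow> ('k::field, 'g \<Rightarrow> 'k) vec_space" where
  "group_algebra G = \<lparr>carrier = {a. \<forall>g. g \<notin> carrier G \<longrightarrow> a g = 0}, scl = fscale\<rparr>"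

definition group_elem :: "'g \<Rightarrow> 'g \<Rightarrow> 'k::field" where
  "group_elem g = (\<lambda>h. if h = g then 1 else 0)"

definition ga_mult ::
  "('g, 'm) monoid_scheme \<Rightarrow> ('g \<Rightarrow> 'k::field) \<Rightarrow> ('g \<Rightarrow> 'k) \<Rightarrow> 'g \<Rightarrow> 'k" where
  "ga_mult G a b = (\<Sum>g\<in>carrier G. \<Sum>h\<in>carrier G. fscale (a g * b h) (group_elem (g \<otimes>\<^bsub>G\<^esub> h)))"

definition ga_comult ::
  "('g, 'm) monoid_scheme \<Rightarrow> ('g \<Rightarrow> 'k::field) \<Rightarrow> ('k, 'g \<Rightarrow> 'k, 'g \<Rightarrow> 'k) tensor" where
  "ga_comult G a = (\<Sum>g\<in>carrier G.
     fscale (a g) (tens (group_algebra G) (group_algebra G) (group_elem g) (group_elem g)))"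

definition ga_counit :: "('g, 'm) monoid_scheme \<Rightarrow> ('g \<Rightarrow> 'k::field) \<Rightarrow> 'k" where
  "ga_counit G a = (\<Sum>g\<in>carrier G. a g)"

definition ga_module ::
  "('g, 'm) monoid_scheme \<Rightarrow> ('k::field, 'v::ab_group_add) vec_space \<Rightarrow>
   (('g \<Rightarrow> 'k) \<Rightarrow> 'v \<Rightarrow> 'v) \<Rightarrow> bool" where
  "ga_module G V act \<longleftrightarrow> bilin_map (group_algebra G) V V act \<and>
     (\<forall>v\<in>carrier V. act (group_elem \<one>\<^bsub>G\<^esub>) v = v) \<and>
     (\<forall>a\<in>carrier (group_algebra G). \<forall>b\<in>carrier (group_algebra G). \<forall>v\<in>carrier V.
        act (ga_mult G a b) v = act a (act b v))"

definition ga_comodule ::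
  "('g, 'm) monoid_scheme \<Rightarrow> ('k::field, 'v::ab_group_add) vec_space \<Rightarrow>
   ('v \<Rightarrow> ('k, 'g \<Rightarrow> 'k, 'v) tensor) \<Rightarrow> bool" where
  "ga_comodule G V \<delta> \<longleftrightarrow>
     (let H = group_algebra G in
       lin_map V (H \<otimes>\<^sub>V V) \<delta> \<and>
       (\<forall>v\<in>carrier V.
          assoc_map H H V (tensor_map H V (H \<otimes>\<^sub>V H) V (ga_comult G) id (\<delta> v)) =
          tensor_map H V H (H \<otimes>\<^sub>V V) id \<delta> (\<delta> v)) \<and>
       (\<forall>v\<in>carrier V. tensor_lift H V V (\<lambda>a w. scl V (ga_counit G a) w) (\<delta> v) = v))"

text \<open>
  The compatibility condition \<open>\<delta>(h \<cdot> v) = h\<^sub>1 v\<^sub>-\<^sub>1 S(h\<^sub>3) \<otimes> h\<^sub>2 \<cdot> v\<^sub>0\<close> is linear in \<open>h\<close>, and for a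
  group-like element \<open>g\<close> it reads \<open>\<delta>(g \<cdot> v) = g v\<^sub>-\<^sub>1 g\<^sup>-\<^sup>1 \<otimes> g \<cdot> v\<^sub>0\<close>.
\<close>

definition yetter_drinfeld ::
  "('g, 'm) monoid_scheme \<Rightarrow> ('k::field, 'v::ab_group_add) vec_space \<Rightarrow>
   (('g \<Rightarrow> 'k) \<Rightarrow> 'v \<Rightarrow> 'v) \<Rightarrow> ('v \<Rightarrow> ('k, 'g \<Rightarrow> 'k, 'v) tensor) \<Rightarrow> bool" where
  "yetter_drinfeld G V act \<delta> \<longleftrightarrow>
     is_vec_space V \<and> ga_module G V act \<and> ga_comodule G V \<delta> \<and>
     (\<forall>g\<in>carrier G. \<forall>v\<in>carrier V.
        \<delta> (act (group_elem g) v) =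
        tensor_map (group_algebra G) V (group_algebra G) V
          (\<lambda>a. ga_mult G (group_elem g) (ga_mult G a (group_elem (inv\<^bsub>G\<^esub> g))))
          (act (group_elem g)) (\<delta> v))"

text \<open>\<open>c(v \<otimes> w) = v\<^sub>-\<^sub>1 \<cdot> w \<otimes> v\<^sub>0\<close>\<close>

definition yd_braiding ::
  "('g, 'm) monoid_scheme \<Rightarrow> ('k::field, 'v::ab_group_add) vec_space \<Rightarrow>
   (('g \<Rightarrow> 'k) \<Rightarrow> 'v \<Rightarrow> 'v) \<Rightarrow> ('v \<Rightarrow> ('k, 'g \<Rightarrow> 'k, 'v) tensor) \<Rightarrow>
   ('k, 'v, 'v) tensor \<Rightarrow> ('k, 'v, 'v) tensor" where
  "yd_braiding G V act \<delta> = tensor_lift V V (V \<otimes>\<^sub>V V)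
     (\<lambda>v w. tensor_lift (group_algebra G) V (V \<otimes>\<^sub>V V) (\<lambda>a u. tens V V (act a w) u) (\<delta> v))"

definition is_root_of_unity :: "'k::field \<Rightarrow> bool" where
  "is_root_of_unity q \<longleftrightarrow> (\<exists>n>0. q ^ n = 1)"

end

theory Submission
  imports Defs "HOL-Algebra.Multiplicative_Group"
begin

text \<open>
  Let \<open>c (y\<^sub>i \<otimes> y\<^sub>j) = g\<^sub>i(y\<^sub>j) \<otimes> y\<^sub>i\<close> on a basis of \<open>V\<close>. The braid equation on \<open>y\<^sub>i \<otimes> y\<^sub>j \<otimes> y\<^sub>k\<close> reads
  \<open>c (g\<^sub>i(y\<^sub>j) \<otimes> g\<^sub>i(y\<^sub>k)) = g\<^sub>i(g\<^sub>j(y\<^sub>k)) \<otimes> g\<^sub>i(y\<^sub>j)\<close>. Expanding \<open>g\<^sub>i(y\<^sub>j)\<close> in the basis and comparing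
  coefficients, one finds that \<open>y\<^sub>a\<close> can only occur in \<open>g\<^sub>i(y\<^sub>j)\<close> if \<open>g\<^sub>a\<close> is the conjugate of \<open>g\<^sub>j\<close> by
  \<open>g\<^sub>i\<close> (\<open>group_type_support\<close>). For a Yetter--Drinfeld module over a finite group the same relations
  hold for a homogeneous basis: the comodule axioms turn the coaction into a grading
  (\<open>homogeneous_decomposition\<close>), and the compatibility condition says how the action moves the degrees
  (\<open>homogeneous_act\<close>). From here on both parts are about operators with these conjugation relations.

  If all \<open>g\<^sub>i\<close> commute, they generate an abelian group, which settles a braided pair of group type.
  For a Yetter--Drinfeld module the \<open>g\<^sub>i\<close> have finite order as well, so they are simultaneously
  diagonalisable, and this can be done inside the spans of the basis vectors with a common operator,
  where the formula for the braiding is preserved (\<open>commuting_eigenbasis\<close>, \<open>commuting_basis\<close>). The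
  coefficients are then eigenvalues of operators of finite order. One should group the basis vectors by
  operator and not by degree: distinct degrees can act by the same operator, and commuting operators
  can still exchange the parts of two such degrees.

  If two of three operators do not commute, the conjugate of one by the other has to be the third.
  Hence no two of them commute and conjugation permutes them like the three reflections of a
  triangle, \<open>i \<rhd> j = - i - j\<close> modulo 3; so \<open>g\<^sub>i(y\<^sub>j) = Q\<^sub>i\<^sub>j y\<^sub>-\<^sub>i\<^sub>-\<^sub>j\<close>
  (\<open>noncommuting_normal_form\<close>). The conjugation relations make \<open>Q\<close> a cocycle, and rescaling the
  basis makes it constant (\<open>dihedral_cocycle_constant\<close>). This is the braiding of \<open>V\<^sub>3\<^sub>,\<^sub>q\<close>. Its parameter
  satisfies \<open>g\<^sub>0(x\<^sub>0) = q x\<^sub>0\<close>, so it is a root of unity if \<open>g\<^sub>0\<close> has finite order.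
\<close>

section \<open>Linear and bilinear maps\<close>

lemma vec_space_subspace:
  assumes "is_vec_space V"
  shows "vector_space (scl V)" "module.subspace (scl V) (carrier V)"
  using assms by (simp_all add: is_vec_space_def)

lemma vec_space_closed:
  assumes "is_vec_space V"
  shows zero_closed: "0 \<in> carrier V"
    and add_closed: "x \<in> carrier V \<Longrightarrow> y \<in> carrier V \<Longrightarrow> x + y \<in> carrier V"
    and scl_closed: "x \<in> carrier V \<Longrightarrow> scl V r x \<in> carrier V"
    and sum_closed: "(\<And>a. a \<in> A \<Longrightarrow> u a \<in> carrier V) \<Longrightarrow> sum u A \<in> carrier V"
proof -
  interpret vector_space "scl V" using assms by (rule vec_space_subspace)
  have s: "subspace (carrier V)" using assms by (rule vec_space_subspace)
  show "0 \<in> carrier V" using s by (rule subspace_0)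
  show "x \<in> carrier V \<Longrightarrow> y \<in> carrier V \<Longrightarrow> x + y \<in> carrier V" using s by (rule subspace_add)
  show "x \<in> carrier V \<Longrightarrow> scl V r x \<in> carrier V" using s by (rule subspace_scale)
  show "(\<And>a. a \<in> A \<Longrightarrow> u a \<in> carrier V) \<Longrightarrow> sum u A \<in> carrier V"
    using s by (rule subspace_sum)
qed

lemma lin_mapD:
  assumes "lin_map V W f"
  shows lin_map_closed: "x \<in> carrier V \<Longrightarrow> f x \<in> carrier W"
    and lin_map_add: "x \<in> carrier V \<Longrightarrow> y \<in> carrier V \<Longrightarrow> f (x + y) = f x + f y"
    and lin_map_scl: "x \<in> carrier V \<Longrightarrow> f (scl V r x) = scl W r (f x)"
  using assms by (auto simp: lin_map_def)

lemma bilin_mapD: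
  assumes "bilin_map V W U \<beta>"
  shows bilin_map_left: "w \<in> carrier W \<Longrightarrow> lin_map V U (\<lambda>v. \<beta> v w)"
    and bilin_map_right: "v \<in> carrier V \<Longrightarrow> lin_map W U (\<beta> v)"
  using assms by (auto simp: bilin_map_def)

lemma lin_map_sum_family:
  assumes V: "is_vec_space V" and W: "is_vec_space W" and f: "lin_map V W f"
    and u: "\<And>a. a \<in> A \<Longrightarrow> u a \<in> carrier V"
  shows "f (sum u A) = (\<Sum>a\<in>A. f (u a))"
  using u
proof (induction A rule: infinite_finite_induct)
  case (insert x F)
  then show ?case by (simp add: lin_map_add[OF f] sum_closed[OF V])
qed (simp_all add: lin_map_zero[OF V W f])

lemma lin_map_id: "lin_map V V id"
  by (simp add: lin_map_def)

lemma lin_map_compose: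
  assumes "lin_map U V f" "lin_map V W h"
  shows "lin_map U W (\<lambda>x. h (f x))"
  using assms by (auto simp: lin_map_def)

lemma lin_map_cong:
  assumes V: "is_vec_space V" and f: "lin_map V W f" and eq: "\<And>x. x \<in> carrier V \<Longrightarrow> h x = f x"
  shows "lin_map V W h"
  using f eq by (simp add: lin_map_def add_closed[OF V] scl_closed[OF V])

lemma lin_map_zero_map: "is_vec_space W \<Longrightarrow> lin_map V W (\<lambda>_. 0)"
proof -
  assume W: "is_vec_space W"
  interpret vector_space "scl W" using W by (rule vec_space_subspace)
  show ?thesis by (simp add: lin_map_def zero_closed[OF W])
qed

lemma lin_map_plus:
  assumes W: "is_vec_space W" and "lin_map V W f" "lin_map V W h"
  shows "lin_map V W (\<lambda>x. f x + h x)"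
proof -
  interpret vector_space "scl W" using W by (rule vec_space_subspace)
  show ?thesis
    using assms(2,3) by (auto simp: lin_map_def add_closed[OF W] scale_right_distrib)
qed

lemma lin_map_scaled:
  assumes W: "is_vec_space W" and "lin_map V W f"
  shows "lin_map V W (\<lambda>x. scl W r (f x))"
proof -
  interpret vector_space "scl W" using W by (rule vec_space_subspace)
  show ?thesis
    using assms(2) by (auto simp: lin_map_def scl_closed[OF W] scale_right_distrib mult.commute)
qed

lemma bilin_map_compose:
  assumes "bilin_map V W U \<beta>" "lin_map V' V f" "lin_map W' W h" "lin_map U U' k"
  shows "bilin_map V' W' U' (\<lambda>v w. k (\<beta> (f v) (h w)))"
  using assms by (auto simp: bilin_map_def lin_map_def)

lemma bilin_map_functional_scale:
  assumes V: "is_vec_space V" and f: "lin_map W base_field f"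
  shows "bilin_map W V V (\<lambda>w v. scl V (f w) v)" "bilin_map V W V (\<lambda>v w. scl V (f w) v)"
proof -
  interpret vector_space "scl V" using V by (rule vec_space_subspace)
  show "bilin_map W V V (\<lambda>w v. scl V (f w) v)" "bilin_map V W V (\<lambda>v w. scl V (f w) v)"
    using f by (auto simp: bilin_map_def lin_map_def base_field_def scl_closed[OF V]
        scale_right_distrib scale_left_distrib mult.commute)
qed

section \<open>Maps on tensor products\<close>

lemma lin_map_tens:
  shows lin_map_tens_left: "w \<in> carrier W \<Longrightarrow> lin_map V (V \<otimes>\<^sub>V W) (\<lambda>v. tens V W v w)"
    and lin_map_tens_right: "v \<in> carrier V \<Longrightarrow> lin_map W (V \<otimes>\<^sub>V W) (tens V W v)"
  using bilin_map_tens[of V W] by (simp_all add: bilin_map_def)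

lemma bilin_map_tens_compose:
  assumes "lin_map V V' f" "lin_map W W' h"
  shows "bilin_map V W (V' \<otimes>\<^sub>V W') (\<lambda>v w. tens V' W' (f v) (h w))"
  using bilin_map_compose[OF bilin_map_tens assms lin_map_id] by simp

lemma tensor_map:
  assumes "is_vec_space V" "is_vec_space W" "lin_map V V' f" "lin_map W W' h"
  shows lin_map_tensor_map: "lin_map (V \<otimes>\<^sub>V W) (V' \<otimes>\<^sub>V W') (tensor_map V W V' W' f h)"
    and tensor_map_tens: "v \<in> carrier V \<Longrightarrow> w \<in> carrier W \<Longrightarrow>
      tensor_map V W V' W' f h (tens V W v w) = tens V' W' (f v) (h w)"
  using tensor_lift[OF assms(1,2) is_vec_space_tensor_prod bilin_map_tens_compose[OF assms(3,4)]]
  by (simp_all add: tensor_map_def)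

text \<open>
  Maps out of an iterated tensor product are built one factor at a time. This needs the map induced
  on \<open>V \<otimes> W\<close> to depend linearly on a further argument \<open>s\<close> whenever \<open>\<beta>\<close> does.
\<close>

lemma bilin_map_tensor_lift:
  assumes V: "is_vec_space V" and W: "is_vec_space W" and U: "is_vec_space U"
    and S: "is_vec_space S"
    and b: "\<And>s. s \<in> carrier S \<Longrightarrow> bilin_map V W U (\<beta> s)"
    and l: "\<And>v w. v \<in> carrier V \<Longrightarrow> w \<in> carrier W \<Longrightarrow> lin_map S U (\<lambda>s. \<beta> s v w)"
  shows "bilin_map (V \<otimes>\<^sub>V W) S U (\<lambda>t s. tensor_lift V W U (\<beta> s) t)"
    and "bilin_map S (V \<otimes>\<^sub>V W) U (\<lambda>s t. tensor_lift V W U (\<beta> s) t)"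
proof -
  note T = is_vec_space_tensor_prod[of V W]
  have lift: "lin_map (V \<otimes>\<^sub>V W) U (tensor_lift V W U (\<beta> s))" if "s \<in> carrier S" for s
    by (rule lin_map_tensor_lift[OF V W U b[OF that]])
  have "lin_map S U (\<lambda>s. tensor_lift V W U (\<beta> s) t)" if "t \<in> carrier (V \<otimes>\<^sub>V W)" for t
    using that
  proof (induction rule: tensor_prod_induct)
    case (tens v w)
    show ?case
      by (rule lin_map_cong[OF S l[OF tens]]) (rule tensor_lift_tens[OF V W U b tens])
  next
    case zero
    show ?case
      by (rule lin_map_cong[OF S lin_map_zero_map[OF U]]) (rule lin_map_zero[OF T U lift])
  next
    case (add t t')
    show ?case
      by (rule lin_map_cong[OF S lin_map_plus[OF U add(3,4)]]) (rule lin_map_add[OF lift add(1,2)])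
  next
    case (scale r t)
    show ?case
      by (rule lin_map_cong[OF S lin_map_scaled[OF U scale(2)]]) (rule lin_map_scl[OF lift scale(1)])
  qed
  with lift show "bilin_map (V \<otimes>\<^sub>V W) S U (\<lambda>t s. tensor_lift V W U (\<beta> s) t)"
    "bilin_map S (V \<otimes>\<^sub>V W) U (\<lambda>s t. tensor_lift V W U (\<beta> s) t)"
    by (auto simp: bilin_map_def)
qed

lemma assoc_map:
  assumes U: "is_vec_space U" and V: "is_vec_space V" and W: "is_vec_space W"
  shows lin_map_assoc_map: "lin_map ((U \<otimes>\<^sub>V V) \<otimes>\<^sub>V W) (U \<otimes>\<^sub>V (V \<otimes>\<^sub>V W)) (assoc_map U V W)"
    and assoc_map_tens: "u \<in> carrier U \<Longrightarrow> v \<in> carrier V \<Longrightarrow> w \<in> carrier W \<Longrightarrow>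
      assoc_map U V W (tens (U \<otimes>\<^sub>V V) W (tens U V u v) w) = tens U (V \<otimes>\<^sub>V W) u (tens V W v w)"
proof -
  note T = is_vec_space_tensor_prod
  let ?\<beta> = "\<lambda>w u v. tens U (V \<otimes>\<^sub>V W) u (tens V W v w)"
  have b: "bilin_map U V (U \<otimes>\<^sub>V (V \<otimes>\<^sub>V W)) (?\<beta> w)" if "w \<in> carrier W" for w
    using bilin_map_tens_compose[OF lin_map_id lin_map_tens_left[OF that]] by simp
  have bb: "bilin_map (U \<otimes>\<^sub>V V) W (U \<otimes>\<^sub>V (V \<otimes>\<^sub>V W))
      (\<lambda>t w. tensor_lift U V (U \<otimes>\<^sub>V (V \<otimes>\<^sub>V W)) (?\<beta> w) t)"
    by (intro bilin_map_tensor_lift U V W T b)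
       (auto intro: lin_map_compose[OF lin_map_tens_right lin_map_tens_right])
  note L = tensor_lift[OF T W T bb]
  show "lin_map ((U \<otimes>\<^sub>V V) \<otimes>\<^sub>V W) (U \<otimes>\<^sub>V (V \<otimes>\<^sub>V W)) (assoc_map U V W)"
    unfolding assoc_map_def by (rule L)
  show "u \<in> carrier U \<Longrightarrow> v \<in> carrier V \<Longrightarrow> w \<in> carrier W \<Longrightarrow>
      assoc_map U V W (tens (U \<otimes>\<^sub>V V) W (tens U V u v) w) = tens U (V \<otimes>\<^sub>V W) u (tens V W v w)"
    unfolding assoc_map_def by (simp add: L(2) tens_in_carrier tensor_lift_tens[OF U V T b])
qed

text \<open>
  The inverse associator is the mirror image of the associator. Injectivity matters because the
  braid equation is phrased through an inverse of the associator on its image.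
\<close>

lemma inj_on_assoc_map:
  assumes U: "is_vec_space U" and V: "is_vec_space V" and W: "is_vec_space W"
  shows "inj_on (assoc_map U V W) (carrier ((U \<otimes>\<^sub>V V) \<otimes>\<^sub>V W))"
proof -
  note T = is_vec_space_tensor_prod
  let ?X = "(U \<otimes>\<^sub>V V) \<otimes>\<^sub>V W" and ?Y = "U \<otimes>\<^sub>V (V \<otimes>\<^sub>V W)" and ?\<alpha> = "assoc_map U V W"
  let ?\<beta> = "\<lambda>u v w. tens (U \<otimes>\<^sub>V V) W (tens U V u v) w"
  have b: "bilin_map V W ?X (?\<beta> u)" if "u \<in> carrier U" for u
    using bilin_map_tens_compose[OF lin_map_tens_right[OF that] lin_map_id] by simp
  have bb: "bilin_map U (V \<otimes>\<^sub>V W) ?X (\<lambda>u t. tensor_lift V W ?X (?\<beta> u) t)"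
    by (intro bilin_map_tensor_lift U V W T b)
       (auto intro: lin_map_compose[OF lin_map_tens_left lin_map_tens_left])
  define \<gamma> where "\<gamma> = tensor_lift U (V \<otimes>\<^sub>V W) ?X (\<lambda>u t. tensor_lift V W ?X (?\<beta> u) t)"
  have lin: "lin_map ?Y ?X \<gamma>"
    unfolding \<gamma>_def by (rule lin_map_tensor_lift[OF U T T bb])
  have val: "\<gamma> (tens U (V \<otimes>\<^sub>V W) u (tens V W v w)) = ?\<beta> u v w"
    if "u \<in> carrier U" "v \<in> carrier V" "w \<in> carrier W" for u v w
    unfolding \<gamma>_def
    using that by (simp add: tensor_lift_tens[OF U T T bb] tens_in_carrier tensor_lift_tens[OF V W T b])
  have inv: "\<gamma> (?\<alpha> t) = t" if "t \<in> carrier ?X" for t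
  proof -
    have pure: "\<gamma> (?\<alpha> (tens (U \<otimes>\<^sub>V V) W s w)) = tens (U \<otimes>\<^sub>V V) W s w"
      if "s \<in> carrier (U \<otimes>\<^sub>V V)" "w \<in> carrier W" for s w
    proof (rule lin_map_tensor_unique[OF T _ _ _ that(1)])
      show "lin_map (U \<otimes>\<^sub>V V) ?X (\<lambda>s. tens (U \<otimes>\<^sub>V V) W s w)"
        by (rule lin_map_tens_left[OF that(2)])
      from lin_map_compose[OF lin_map_compose[OF this lin_map_assoc_map[OF U V W]] lin]
      show "lin_map (U \<otimes>\<^sub>V V) ?X (\<lambda>s. \<gamma> (?\<alpha> (tens (U \<otimes>\<^sub>V V) W s w)))" .
    qed (simp add: assoc_map_tens[OF U V W] val that(2))
    show ?thesis
      by (rule lin_map_tensor_unique[OF T lin_map_compose[OF lin_map_assoc_map[OF U V W] lin]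
          lin_map_id[unfolded id_def] pure that])
  qed
  show ?thesis by (rule inj_on_inverseI[of _ \<gamma>]) (rule inv)
qed

text \<open>
  Slicing a tensor with a functional on one factor. With coordinate functionals, this is how an
  identity between tensors is split into identities between vectors.
\<close>

lemma contract_right:
  assumes V: "is_vec_space V" and W: "is_vec_space W" and f: "lin_map W base_field f"
  obtains h where "lin_map (V \<otimes>\<^sub>V W) V h"
    and "\<And>v w. v \<in> carrier V \<Longrightarrow> w \<in> carrier W \<Longrightarrow> h (tens V W v w) = scl V (f w) v"
  using tensor_lift[OF V W V bilin_map_functional_scale(2)[OF V f]] by blast

lemma contract_left:
  assumes V: "is_vec_space V" and W: "is_vec_space W" and f: "lin_map V base_field f"
  obtains h where "lin_map (V \<otimes>\<^sub>V W) W h"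
    and "\<And>v w. v \<in> carrier V \<Longrightarrow> w \<in> carrier W \<Longrightarrow> h (tens V W v w) = scl W (f v) w"
  using tensor_lift[OF V W W bilin_map_functional_scale(1)[OF W f]] by blast

section \<open>Roots of unity\<close>

text \<open>
  \<open>X\<^sup>N - 1\<close> splits over an algebraically closed field, and in characteristic 0 it has no common
  root with its derivative \<open>N X\<^sup>N\<^sup>-\<^sup>1\<close>. So it has \<open>N\<close> distinct roots.
\<close>

lemma card_roots_of_unity:
  assumes "N > 0"
  shows "card {z :: 'k::{alg_closed_field, field_char_0}. z ^ N = 1} = N"
proof -
  let ?p = "Polynomial.monom 1 N - 1 :: 'k poly"
  have deg: "degree ?p = N"
    using assms degree_add_eq_left[of "-1" "Polynomial.monom 1 N :: 'k poly"] by (simp add: degree_monom_eq)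
  then have nz: "?p \<noteq> 0" using assms by auto
  have poly: "poly ?p z = z ^ N - 1" for z by (simp add: poly_monom)
  have "rsquarefree ?p"
    unfolding rsquarefree_roots
    using assms by (auto simp: poly pderiv_diff pderiv_monom poly_monom power_0_left)
  then have one: "count (proots ?p) z = (if z \<in> {z. z ^ N = 1} then 1 else 0)" for z
    using nz rsquarefree_root_order[of ?p z] order_root[of ?p z]
    by (simp add: poly_monom del: One_nat_def)
  have set: "set_mset (proots ?p) = {z. z ^ N = 1}"
    using nz by (simp add: poly_monom)
  obtain A where A: "size A = degree ?p" "?p = Polynomial.smult (lead_coeff ?p) (\<Prod>x\<in>#A. [:-x, 1:])"
    using alg_closed_imp_factorization[OF nz] by blast
  have lin: "proots (\<Prod>x\<in>#B. [:-x, 1:]) = B" for B :: "'k multiset"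
  proof (induction B)
    case (add x B)
    have "(\<Prod>x\<in>#B. [:-x, 1:]) \<noteq> (0 :: 'k poly)" by (auto simp: prod_mset_zero_iff)
    then have "proots ([:-x, 1:] * (\<Prod>x\<in>#B. [:-x, 1:])) = {#x#} + proots (\<Prod>x\<in>#B. [:-x, 1:])"
      by (subst proots_mult) auto
    with add show ?case by (simp del: mult_pCons_left)
  qed simp
  have "proots ?p = A"
    using nz lin[of A] proots_smult A(2) by (metis leading_coeff_0_iff)
  then have "N = size (proots ?p)" using A deg by simp
  also have "\<dots> = (\<Sum>z\<in>{z. z ^ N = 1}. count (proots ?p) z)"
    unfolding size_multiset_overloaded_eq set ..
  also have "\<dots> = card {z :: 'k. z ^ N = 1}"
    unfolding one by simp
  finally show ?thesis ..
qed

text \<open>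
  Multiplication by a root of unity that is not an \<open>m\<close>-th root of unity permutes the summands,
  so the sum is fixed by a factor different from 1.
\<close>

lemma sum_powers_roots_of_unity:
  assumes card: "card {z :: 'k::field. z ^ N = 1} = N" and m: "0 < m" "m < N"
  shows "(\<Sum>z | z ^ N = 1. z ^ m) = (0 :: 'k)"
proof -
  let ?R = "{z :: 'k. z ^ N = 1}"
  let ?p = "Polynomial.monom 1 m - 1 :: 'k poly"
  have deg: "degree ?p = m"
    using m degree_add_eq_left[of "-1" "Polynomial.monom 1 m :: 'k poly"] by (simp add: degree_monom_eq)
  then have "?p \<noteq> 0" using m by auto
  then have "card {z :: 'k. z ^ m = 1} \<le> m" "finite {z :: 'k. z ^ m = 1}"
    using card_poly_roots_bound[of ?p] poly_roots_finite[of ?p] deg by (simp_all add: poly_monom)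
  with card m(2) have "\<not> ?R \<subseteq> {z. z ^ m = 1}"
    using card_mono[of "{z :: 'k. z ^ m = 1}" ?R] by auto
  then obtain w :: 'k where w: "w ^ N = 1" "w ^ m \<noteq> 1" by auto
  then have w0: "w \<noteq> 0" using m by (auto simp: power_0_left)
  have "(\<Sum>z\<in>?R. z ^ m) = (\<Sum>z\<in>?R. (w * z) ^ m)"
    using w w0
    by (intro sum.reindex_bij_witness[of _ "\<lambda>z. w * z" "\<lambda>z. z / w"])
       (auto simp: power_mult_distrib power_divide)
  also have "\<dots> = w ^ m * (\<Sum>z\<in>?R. z ^ m)"
    by (simp add: power_mult_distrib sum_distrib_left)
  finally have "(w ^ m - 1) * (\<Sum>z\<in>?R. z ^ m) = 0" by (simp add: algebra_simps)
  with w show ?thesis by simp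
qed

section \<open>Diagonalising operators of finite order\<close>

context vector_space
begin

text \<open>
  A basis chosen inside a spanning family of \<open>dim UNIV\<close> vectors has as many elements as the family,
  so it is the whole family and the family has no repetitions.
\<close>

lemma spanning_family_is_basis:
  assumes "finite I" "card I = dim UNIV" "span (x ` I) = UNIV"
  shows "inj_on x I" and "independent (x ` I)"
proof -
  obtain B where B: "B \<subseteq> x ` I" "independent B" "x ` I \<subseteq> span B"
    by (rule maximal_independent_subset)
  have "card B = dim (x ` I)" using basis_card_eq_dim[OF B(1,3,2)] .
  also have "\<dots> = card I" using assms by (metis dim_span)
  finally have cB: "card B = card I" .
  have "card (x ` I) \<le> card I" using assms(1) by (rule card_image_le)
  with B(1) cB assms(1) have eq: "B = x ` I" by (intro card_seteq) auto
  then show "independent (x ` I)" using B by simp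
  show "inj_on x I" using assms(1) cB eq by (intro eq_card_imp_inj_on) auto
qed

text \<open>
  The projection onto an eigenspace of an operator \<open>T\<close> with \<open>T\<^sup>N = 1\<close> is the discrete Fourier
  coefficient \<open>(1/N) \<Sum>\<^sub>m z\<^sup>m T\<^sup>m\<close>, where \<open>z\<close> is the inverse of the eigenvalue.
\<close>

lemma finite_order_eigenvectors_span:
  assumes card: "card {z :: 'a. z ^ N = 1} = N" and N: "(of_nat N :: 'a) \<noteq> 0"
    and T: "Vector_Spaces.linear scale scale T" and TN: "\<And>v. v \<in> W \<Longrightarrow> (T ^^ N) v = v"
    and W: "subspace W" and inv: "T ` W \<subseteq> W"
  shows "W \<subseteq> span {w \<in> W. \<exists>z. z ^ N = 1 \<and> T w = scale z w}"
proof
  fix v assume v: "v \<in> W"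
  interpret T: Vector_Spaces.linear scale scale T by (rule T)
  let ?R = "{z :: 'a. z ^ N = 1}"
  have N0: "N > 0" using N by (cases N) auto
  then have finR: "finite ?R" using card by (metis card.infinite less_numeral_extra(3))
  define E where "E z = scale (1 / of_nat N) (\<Sum>m<N. scale (z ^ m) ((T ^^ m) v))" for z
  have pow: "(T ^^ m) v \<in> W" for m
    using v inv by (induction m) auto
  have EW: "E z \<in> W" for z
    unfolding E_def using W pow by (intro subspace_scale subspace_sum) auto
  have eig: "T (E z) = scale (inverse z) (E z)" if z: "z \<in> ?R" for z
  proof -
    let ?f = "\<lambda>m. scale (z ^ m) ((T ^^ m) v)"
    have z0: "z \<noteq> 0" using z N0 by (auto simp: power_0_left)
    have "?f N = ?f 0" using z TN[OF v] by simp
    then have cyc: "(\<Sum>m<N. ?f (Suc m)) = (\<Sum>m<N. ?f m)"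
      using sum.lessThan_Suc_shift[of ?f N] by simp
    have canc: "inverse z * (z * r) = r" for r using z0 by simp
    have "T (E z) = scale (1 / of_nat N) (\<Sum>m<N. scale (z ^ m) ((T ^^ Suc m) v))"
      unfolding E_def by (simp add: T.scale T.sum)
    also have "\<dots> = scale (1 / of_nat N) (scale (inverse z) (\<Sum>m<N. ?f (Suc m)))"
      by (simp add: scale_sum_right canc)
    finally show ?thesis unfolding cyc E_def by (simp add: mult.commute)
  qed
  \<comment> \<open>In the sum of all projections only the term \<open>m = 0\<close> survives, \<open>N\<close> times.\<close>
  have "(\<Sum>z\<in>?R. E z) = scale (1 / of_nat N) (\<Sum>m<N. \<Sum>z\<in>?R. scale (z ^ m) ((T ^^ m) v))"
    unfolding E_def by (subst sum.swap) (simp add: scale_sum_right)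
  also have "(\<Sum>m<N. \<Sum>z\<in>?R. scale (z ^ m) ((T ^^ m) v))
      = (\<Sum>m<N. if m = 0 then scale (of_nat N) v else 0)"
    using sum_powers_roots_of_unity[OF card]
    by (intro sum.cong refl) (auto simp: scale_sum_left[symmetric] card)
  also have "\<dots> = scale (of_nat N) v" using N0 by simp
  finally have "(\<Sum>z\<in>?R. E z) = v" using N by simp
  moreover have "(\<Sum>z\<in>?R. E z) \<in> span {w \<in> W. \<exists>z. z ^ N = 1 \<and> T w = scale z w}"
    using EW eig by (intro span_sum span_base) (auto simp: power_inverse intro: exI[of _ "inverse _"])
  ultimately show "v \<in> span {w \<in> W. \<exists>z. z ^ N = 1 \<and> T w = scale z w}" by simp
qed

text \<open>
  Adding one operator at a time keeps the eigenvectors found so far, because a joint eigenspace of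
  some of the operators is stable under the others. The subspace \<open>W\<close> is carried along so that the
  eigenvectors can later be chosen inside the homogeneous parts of a grading.
\<close>

lemma commuting_finite_order_eigenvectors_span:
  assumes card: "card {z :: 'a. z ^ N = 1} = N" and N: "(of_nat N :: 'a) \<noteq> 0" and fin: "finite J"
    and T: "\<And>j. j \<in> J \<Longrightarrow> Vector_Spaces.linear scale scale (T j)" and TN: "\<And>j v. j \<in> J \<Longrightarrow> (T j ^^ N) v = v"
    and comm: "\<And>i j v. i \<in> J \<Longrightarrow> j \<in> J \<Longrightarrow> T i (T j v) = T j (T i v)"
    and W: "subspace W" and inv: "\<And>j. j \<in> J \<Longrightarrow> T j ` W \<subseteq> W"
  shows "W \<subseteq> span {w \<in> W. \<forall>j\<in>J. \<exists>z. z ^ N = 1 \<and> T j w = scale z w}"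
  using fin T TN comm inv
proof (induction J rule: finite_induct)
  case empty
  show ?case by (simp add: span_superset)
next
  case (insert i F)
  let ?S = "{w \<in> W. \<forall>j\<in>insert i F. \<exists>z. z ^ N = 1 \<and> T j w = scale z w}"
  have "W \<subseteq> span {w \<in> W. \<forall>j\<in>F. \<exists>z. z ^ N = 1 \<and> T j w = scale z w}"
    using insert.prems by (intro insert.IH) auto
  also have "\<dots> \<subseteq> span ?S"
  proof (rule span_minimal[OF _ subspace_span], rule subsetI)
    fix w assume "w \<in> {w \<in> W. \<forall>j\<in>F. \<exists>z. z ^ N = 1 \<and> T j w = scale z w}"
    then have w: "w \<in> W" "\<forall>j\<in>F. \<exists>z. z ^ N = 1 \<and> T j w = scale z w" by auto
    then obtain \<chi> where \<chi>: "\<forall>j\<in>F. \<chi> j ^ N = 1 \<and> T j w = scale (\<chi> j) w"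
      using bchoice[OF w(2)] by blast
    \<comment> \<open>\<open>T i\<close> commutes with the other operators, so it preserves their joint eigenspace.\<close>
    define W' where "W' = {u \<in> W. \<forall>j\<in>F. T j u = scale (\<chi> j) u}"
    have Ti: "Vector_Spaces.linear scale scale (T i)" using insert.prems by simp
    have lin: "T j 0 = 0" "T j (u + v) = T j u + T j v" "T j (scale r u) = scale r (T j u)"
      if "j \<in> insert i F" for j u v r
    proof -
      interpret Vector_Spaces.linear scale scale "T j" using insert.prems that by simp
      show "T j 0 = 0" "T j (u + v) = T j u + T j v" "T j (scale r u) = scale r (T j u)"
        by (simp_all add: add scale)
    qed
    have sub: "subspace W'"
      using W unfolding W'_def subspace_def by (auto simp: lin scale_right_distrib mult.commute)
    have "T i ` W' \<subseteq> W'"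
    proof (rule image_subsetI)
      fix u assume u: "u \<in> W'"
      have "T j (T i u) = scale (\<chi> j) (T i u)" if j: "j \<in> F" for j
      proof -
        have "T j (T i u) = T i (T j u)" using insert.prems(3) j by simp
        also have "T j u = scale (\<chi> j) u" using u j by (simp add: W'_def)
        finally show ?thesis by (simp add: lin(3))
      qed
      moreover have "T i u \<in> W" using insert.prems(4)[of i] u by (auto simp: W'_def)
      ultimately show "T i u \<in> W'" by (simp add: W'_def)
    qed
    then have "W' \<subseteq> span {u \<in> W'. \<exists>z. z ^ N = 1 \<and> T i u = scale z u}"
      using insert.prems by (intro finite_order_eigenvectors_span card N Ti sub) auto
    also have "\<dots> \<subseteq> span ?S"
      using \<chi> unfolding W'_def by (intro span_mono) blast
    finally show "w \<in> span ?S" using w(1) \<chi> by (auto simp: W'_def)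
  qed
  finally show ?case .
qed

end

section \<open>Families of operators indexed by a basis and closed under conjugation\<close>

text \<open>
  The axiom \<open>conj\<close> is the linear form of a grading by operators. Give \<open>y a\<close> the degree \<open>g a\<close>; then
  \<open>g i\<close> maps a basis vector of degree \<open>g j\<close> into the part of degree \<open>g i \<circ> g j \<circ> inv (g i)\<close>. The inverse
  is avoided by composing with \<open>g i\<close> on the right.
\<close>

locale conjugating_family = vector_space scale
  for scale :: "'a::field \<Rightarrow> 'b::ab_group_add \<Rightarrow> 'b" +
  fixes I :: "'i set" and y :: "'i \<Rightarrow> 'b" and g :: "'i \<Rightarrow> 'b \<Rightarrow> 'b"
  assumes finite_index: "finite I"
    and basis: "inj_on y I" "independent (y ` I)" "span (y ` I) = UNIV"
    and lin: "\<And>i. i \<in> I \<Longrightarrow> Vector_Spaces.linear scale scale (g i)"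
    and bij: "\<And>i. i \<in> I \<Longrightarrow> bij (g i)"
    and conj: "\<And>i j. i \<in> I \<Longrightarrow> j \<in> I \<Longrightarrow> g i (y j) \<in> span (y ` {a \<in> I. g a \<circ> g i = g i \<circ> g j})"
begin

lemma g_cancel:
  assumes "i \<in> I"
  shows "g i \<circ> f = g i \<circ> h \<longleftrightarrow> f = h" and "f \<circ> g i = h \<circ> g i \<longleftrightarrow> f = h"
  using bij[OF assms] by (auto simp: fun_eq_iff bij_def inj_eq surj_def) metis

lemma g_basis_nonzero:
  assumes "i \<in> I" "j \<in> I"
  shows "g i (y j) \<noteq> 0"
proof -
  interpret Vector_Spaces.linear scale scale "g i" by (rule lin[OF assms(1)])
  have "y j \<noteq> 0" using basis(2) assms(2) dependent_zero by (metis imageI)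
  then show ?thesis using bij[OF assms(1)] zero by (metis bij_def injD)
qed

text \<open>
  The vector \<open>g i (y j)\<close> is not 0, so the conjugate of \<open>g j\<close> by \<open>g i\<close> occurs among the operators. If
  \<open>g i\<close> and \<open>g j\<close> do not commute, this conjugate is neither \<open>g i\<close> nor \<open>g j\<close>.
\<close>

lemma conj_noncommuting:
  assumes ijk: "I = {i, j, k}" and nc: "g i \<circ> g j \<noteq> g j \<circ> g i"
  shows "{a \<in> I. g a \<circ> g i = g i \<circ> g j} = {k}"
proof -
  let ?A = "{a \<in> I. g a \<circ> g i = g i \<circ> g j}"
  have i: "i \<in> I" and j: "j \<in> I" using ijk by auto
  have "?A \<noteq> {}"
  proof
    assume "?A = {}"
    with conj[OF i j] have "g i (y j) \<in> span (y ` {})" by simp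
    with g_basis_nonzero[OF i j] show False by simp
  qed
  moreover have "j \<notin> ?A" using nc by auto
  moreover have "i \<notin> ?A" using nc g_cancel(1)[OF i] by auto
  ultimately show ?thesis using ijk by auto
qed

text \<open>
  If \<open>g i\<close> commuted with \<open>g k\<close>, the conjugation relation \<open>g k \<circ> g i = g i \<circ> g j\<close> would force
  \<open>g k = g j\<close>, and the relation with \<open>i\<close> and \<open>j\<close> exchanged would then force \<open>g j = g i\<close>.
\<close>

lemma noncommuting_spreads:
  assumes ijk: "I = {i, j, k}" and nc: "g i \<circ> g j \<noteq> g j \<circ> g i"
  shows "g i \<circ> g k \<noteq> g k \<circ> g i"
proof
  have I: "i \<in> I" "j \<in> I" using ijk by auto
  have k: "g k \<circ> g i = g i \<circ> g j" "g k \<circ> g j = g j \<circ> g i"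
    using conj_noncommuting[of i j k] conj_noncommuting[of j i k] ijk nc by (auto simp: insert_commute)
  assume "g i \<circ> g k = g k \<circ> g i"
  then have "g k = g j" using k(1) g_cancel(1)[OF I(1)] by simp
  with k(2) have "g j = g i" using g_cancel(1)[OF I(2)] by simp
  with nc show False by simp
qed

end

lemma exhaust_mod3: "(a::3) = 0 \<or> a = 1 \<or> a = 2"
proof (cases a)
  case (of_int z)
  then have "z = 0 \<or> z = 1 \<or> z = 2" by auto
  with of_int show ?thesis by auto
qed

lemma forall_mod3: "(\<forall>a::3. P a) \<longleftrightarrow> P 0 \<and> P 1 \<and> P 2"
  by (metis exhaust_mod3)

lemma UNIV_mod3_distinct: "a \<noteq> b \<Longrightarrow> (UNIV :: 3 set) = {a, b, - a - b}"
proof -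
  have "\<forall>a b c::3. a \<noteq> b \<longrightarrow> c = a \<or> c = b \<or> c = - a - b"
    unfolding forall_mod3 by simp
  then show "a \<noteq> b \<Longrightarrow> ?thesis" by blast
qed

text \<open>
  A solution of the cocycle condition on the rack of reflections of a triangle is, up to a change of
  basis vectors by scalars, the constant \<open>Q 0 0\<close>: the three values \<open>Q a a\<close> agree, and the rescaling
  is forced by \<open>(a, b) = (0, 1)\<close> and \<open>(1, 0)\<close> up to a common factor.
\<close>

lemma dihedral_cocycle_constant:
  fixes Q :: "3 \<Rightarrow> 3 \<Rightarrow> 'a::field"
  assumes nz: "\<And>a b. Q a b \<noteq> 0"
    and cocycle: "\<And>a b c. Q b c * Q a (- b - c) = Q a c * Q (- a - b) (- a - c)"
  obtains \<mu> q where "q \<noteq> 0" "\<And>a. \<mu> a \<noteq> 0" "\<And>a b. Q a b * \<mu> b = q * \<mu> (- a - b)"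
proof -
  define q where "q = Q 0 0"
  have [simp]: "- 1 = (2::3)" "- 2 = (1::3)" "1 - 2 = (2::3)" "2 - 1 = (1::3)"
    by simp_all
  have diag: "Q 1 1 = q" "Q 2 2 = q"
    using cocycle[of 0 0 1] cocycle[of 0 0 2] by (simp_all add: q_def nz)
  have tri: "Q 2 0 * Q 0 1 = q * Q 1 0" "Q 2 1 * Q 1 0 = q * Q 0 1"
    "Q 1 0 * Q 0 2 = q * Q 2 0" "Q 0 1 * Q 1 2 = q * Q 2 1"
    using cocycle[of 2 0 0] cocycle[of 2 1 1] cocycle[of 1 0 0] cocycle[of 0 1 1]
    by (simp_all add: diag flip: q_def)
  \<comment> \<open>The two relations through \<open>Q 1 0\<close> and \<open>Q 2 0\<close>, multiplied and cancelled.\<close>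
  have "(Q 0 2 * Q 0 1) * (Q 2 0 * Q 1 0) = (q * q) * (Q 2 0 * Q 1 0)"
    using arg_cong2[OF tri(1,3), of "(*)"] by (simp add: ac_simps)
  then have sq0: "Q 0 2 * Q 0 1 = q * q" by (simp add: nz)
  have "(Q 1 2 * Q 1 0) * (Q 2 1 * Q 0 1) = (q * q) * (Q 2 1 * Q 0 1)"
    using arg_cong2[OF tri(2,4), of "(*)"] by (simp add: ac_simps)
  then have sq1: "Q 1 2 * Q 1 0 = q * q" by (simp add: nz)
  define \<mu> :: "3 \<Rightarrow> 'a" where
    "\<mu> a = (if a = 0 then Q 0 1 / Q 1 0 else if a = 1 then 1 else Q 0 1 / q)" for a
  have q0: "q \<noteq> 0" using nz by (simp add: q_def)
  have "\<forall>a b. Q a b * \<mu> b = q * \<mu> (- a - b)"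
    unfolding forall_mod3 using q0 nz diag tri sq0 sq1
    by (simp add: \<mu>_def field_simps flip: q_def)
  then show thesis
    using q0 nz by (intro that[of q \<mu>]) (auto simp: \<mu>_def)
qed

context conjugating_family
begin

text \<open>
  If two of three operators do not commute, no two of them commute, and they are permuted by
  conjugation like the reflections of a triangle. Then every \<open>g i (y j)\<close> is a multiple of a
  basis vector. Comparing scalars in the conjugation relations shows that these multiples form a
  cocycle.
\<close>

lemma noncommuting_normal_form:
  assumes card: "card I = 3" and nc: "\<not> (\<forall>i\<in>I. \<forall>j\<in>I. g i \<circ> g j = g j \<circ> g i)"
  obtains \<sigma> :: "3 \<Rightarrow> 'i" and \<mu> q where "bij_betw \<sigma> UNIV I" "q \<noteq> 0" "\<And>a. \<mu> a \<noteq> 0"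
    "\<And>a b. g (\<sigma> a) (scale (\<mu> b) (y (\<sigma> b)))
       = scale q (scale (\<mu> (- a - b)) (y (\<sigma> (- a - b))))"
proof -
  obtain i j where ij: "i \<in> I" "j \<in> I" "g i \<circ> g j \<noteq> g j \<circ> g i" using nc by blast
  then have "i \<noteq> j" by auto
  then have "card (I - {i, j}) = 1" using card ij by (simp add: card_Diff_subset)
  then obtain k where "I - {i, j} = {k}" by (rule card_1_singletonE)
  then have k: "I = {i, j, k}" "k \<noteq> i" "k \<noteq> j" using ij by auto
  then have perm: "I = {j, i, k}" "I = {i, k, j}" "I = {k, i, j}" by auto
  have ik: "g i \<circ> g k \<noteq> g k \<circ> g i" by (rule noncommuting_spreads[OF k(1) ij(3)])
  have jk: "g j \<circ> g k \<noteq> g k \<circ> g j" by (rule noncommuting_spreads[OF perm(1) ij(3)[symmetric]])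
  have all: "g a \<circ> g b \<noteq> g b \<circ> g a" if "a \<in> I" "b \<in> I" "a \<noteq> b" for a b
    using that ij(3) ik jk k(1) by auto
  obtain \<sigma> :: "3 \<Rightarrow> 'i" where \<sigma>: "bij_betw \<sigma> UNIV I"
    using finite_same_card_bij[of "UNIV :: 3 set" I] card finite_index by auto
  then have I: "\<sigma> a \<in> I" and inj: "\<sigma> a = \<sigma> b \<longleftrightarrow> a = b" for a b
    by (auto simp: bij_betw_def inj_eq)
  have conj_set: "{x \<in> I. g x \<circ> g (\<sigma> a) = g (\<sigma> a) \<circ> g (\<sigma> b)} = {\<sigma> (- a - b)}" for a b
  proof (cases "a = b")
    case False
    have "I = \<sigma> ` {a, b, - a - b}"
      using \<sigma> UNIV_mod3_distinct[OF False] by (simp add: bij_betw_def)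
    then have "I = {\<sigma> a, \<sigma> b, \<sigma> (- a - b)}" by simp
    then show ?thesis by (rule conj_noncommuting) (simp add: all I inj False)
  next
    case True
    \<comment> \<open>A reflection is its own conjugate, and only its own because the others do not commute with it.\<close>
    have "\<forall>a::3. - a - a = a" unfolding forall_mod3 by simp
    then have e: "- a - b = a" using True by simp
    have "x = \<sigma> a" if "x \<in> I" "g x = g (\<sigma> a)" for x
      using all[OF that(1) I[of a]] that(2) by auto
    then show ?thesis unfolding e unfolding True[symmetric] using I by (auto simp: g_cancel)
  qed
  \<comment> \<open>Applied to the basis vectors, this relation will be the cocycle condition.\<close>
  have rel: "g (\<sigma> (- a - b)) (g (\<sigma> a) v) = g (\<sigma> a) (g (\<sigma> b) v)" for a b v
    using conj_set[of a b] by (auto simp: fun_eq_iff)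
  have scl: "g (\<sigma> a) (scale r v) = scale r (g (\<sigma> a) v)" for a r v
  proof -
    interpret Vector_Spaces.linear scale scale "g (\<sigma> a)" using lin I .
    show ?thesis by (rule scale)
  qed
  have "\<exists>r. g (\<sigma> a) (y (\<sigma> b)) = scale r (y (\<sigma> (- a - b)))" for a b
    using conj[OF I I, of a b] unfolding conj_set by (auto simp: span_singleton)
  then obtain Q where Q: "g (\<sigma> a) (y (\<sigma> b)) = scale (Q a b) (y (\<sigma> (- a - b)))" for a b
    by metis
  have nz: "Q a b \<noteq> 0" for a b
    using g_basis_nonzero[OF I I, of a b] Q by auto
  have y0: "y (\<sigma> a) \<noteq> 0" for a using basis(2) I dependent_zero by (metis imageI)
  have "Q b c * Q a (- b - c) = Q a c * Q (- a - b) (- a - c)" for a b c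
  proof -
    have "\<forall>a b c::3. - a - (- b - c) = - (- a - b) - (- a - c)"
      unfolding forall_mod3 by simp
    then have e: "- a - (- b - c) = - (- a - b) - (- a - c)" by blast
    have "scale (Q a c * Q (- a - b) (- a - c)) (y (\<sigma> (- (- a - b) - (- a - c))))
        = scale (Q b c * Q a (- b - c)) (y (\<sigma> (- (- a - b) - (- a - c))))"
      using rel[of a b "y (\<sigma> c)"] by (simp only: Q scl scale_scale e)
    then show ?thesis using y0 by (simp only: scale_cancel_right) simp
  qed
  from dihedral_cocycle_constant[OF nz this] obtain \<mu> q where
    q: "q \<noteq> 0" "\<And>a. \<mu> a \<noteq> 0" "\<And>a b. Q a b * \<mu> b = q * \<mu> (- a - b)" by metis
  show thesis
  proof (rule that[of \<sigma> q \<mu>, OF \<sigma> q(1,2)])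
    fix a b
    show "g (\<sigma> a) (scale (\<mu> b) (y (\<sigma> b)))
        = scale q (scale (\<mu> (- a - b)) (y (\<sigma> (- a - b))))"
      using q(3)[of a b] by (simp add: scl Q mult.commute)
  qed
qed

text \<open>
  If all the operators commute, each of them preserves the span of the basis vectors that share
  their operator. A joint eigenbasis can thus be chosen inside these spans.
\<close>

lemma commuting_eigenbasis:
  assumes card: "card {z :: 'a. z ^ N = 1} = N" and N: "(of_nat N :: 'a) \<noteq> 0"
    and comm: "\<forall>i\<in>I. \<forall>j\<in>I. g i \<circ> g j = g j \<circ> g i"
    and order: "\<And>i. i \<in> I \<Longrightarrow> g i ^^ N = id"
  obtains B where "independent B" "span B = UNIV"
    "\<And>b. b \<in> B \<Longrightarrow> \<exists>i\<in>I. b \<in> span (y ` {a \<in> I. g a = g i}) \<and>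
      (\<forall>j\<in>I. \<exists>z. z ^ N = 1 \<and> g j b = scale z b)"
proof -
  define W where "W i = span (y ` {a \<in> I. g a = g i})" for i
  define S where "S = {b. \<exists>i\<in>I. b \<in> W i \<and> (\<forall>j\<in>I. \<exists>z. z ^ N = 1 \<and> g j b = scale z b)}"
  have inv: "g j ` W i \<subseteq> W i" if i: "i \<in> I" and j: "j \<in> I" for i j
  proof -
    interpret Vector_Spaces.linear scale scale "g j" using lin[OF j] .
    have "g j (y a) \<in> W i" if a: "a \<in> I" "g a = g i" for a
    proof -
      have "{b \<in> I. g b \<circ> g j = g j \<circ> g a} = {b \<in> I. g b = g i}"
        using comm a j g_cancel(2)[OF j] by metis
      then show ?thesis using conj[OF j a(1)] by (simp add: W_def)
    qed
    then have "g j ` (y ` {a \<in> I. g a = g i}) \<subseteq> W i" by auto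
    then show ?thesis unfolding W_def span_image[symmetric]
      by (rule span_minimal) (rule subspace_span)
  qed
  have "W i \<subseteq> span S" if i: "i \<in> I" for i
  proof -
    have "W i \<subseteq> span {w \<in> W i. \<forall>j\<in>I. \<exists>z. z ^ N = 1 \<and> g j w = scale z w}"
      using comm order inv[OF i] subspace_span
      by (intro commuting_finite_order_eigenvectors_span card N finite_index lin)
         (auto simp: fun_eq_iff W_def)
    also have "\<dots> \<subseteq> span S"
      using i by (intro span_mono) (auto simp: S_def)
    finally show ?thesis .
  qed
  moreover have "y i \<in> W i" if "i \<in> I" for i
    using that unfolding W_def by (intro span_base) auto
  ultimately have "y ` I \<subseteq> span S" by blast
  then have S: "span S = UNIV"
    using span_minimal[OF _ subspace_span] basis(3) by blast
  obtain B where B: "B \<subseteq> S" "independent B" "S \<subseteq> span B"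
    by (rule maximal_independent_subset)
  have "span B = UNIV" using span_minimal[OF B(3) subspace_span] S by auto
  with B show thesis by (intro that) (auto simp: S_def W_def)
qed

end

section \<open>Braided pairs of group type\<close>

definition coord :: "('k::field, 'v::ab_group_add) vec_space \<Rightarrow> 'i set \<Rightarrow> ('i \<Rightarrow> 'v) \<Rightarrow> 'i \<Rightarrow> 'v \<Rightarrow> 'k"
  where "coord V I y i v = module.representation (scl V) (y ` I) v (y i)"

lemma basis_family_closed:
  assumes V: "is_vec_space V" and y: "basis_family V I y" and "i \<in> I"
  shows "y i \<in> carrier V"
proof -
  interpret vector_space "scl V" using V by (rule vec_space_subspace)
  show ?thesis using assms span_base[of "y i" "y ` I"] by (auto simp: basis_family_def)
qed

lemma coord:
  assumes V: "is_vec_space V" and y: "basis_family V I y"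
  shows lin_map_coord: "lin_map V base_field (coord V I y i)"
    and coord_basis: "i \<in> I \<Longrightarrow> j \<in> I \<Longrightarrow> coord V I y i (y j) = (if i = j then 1 else 0)"
    and coord_expansion: "finite I \<Longrightarrow> v \<in> carrier V \<Longrightarrow> v = (\<Sum>i\<in>I. scl V (coord V I y i v) (y i))"
proof -
  interpret vector_space "scl V" using V by (rule vec_space_subspace)
  have y': "inj_on y I" "independent (y ` I)" "span (y ` I) = carrier V"
    using y by (auto simp: basis_family_def)
  show "lin_map V base_field (coord V I y i)"
    unfolding lin_map_def coord_def base_field_def
    using y' by (simp add: representation_add representation_scale)
  show "i \<in> I \<Longrightarrow> j \<in> I \<Longrightarrow> coord V I y i (y j) = (if i = j then 1 else 0)"
    using y' by (auto simp: coord_def representation_basis inj_on_eq_iff)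
  show "v = (\<Sum>i\<in>I. scl V (coord V I y i v) (y i))" if "finite I" "v \<in> carrier V"
  proof -
    have "(\<Sum>b\<in>y ` I. scl V (representation (y ` I) v b) b) = v"
      using y' that by (intro sum_representation_eq) auto
    then show ?thesis using y'(1) by (simp add: sum.reindex coord_def)
  qed
qed

lemma lin_map_expansion:
  assumes V: "is_vec_space V" and W: "is_vec_space W" and fin: "finite I" and y: "basis_family V I y"
    and f: "lin_map V W f" and v: "v \<in> carrier V"
  shows "f v = (\<Sum>i\<in>I. scl W (coord V I y i v) (f (y i)))"
proof -
  have c: "scl V (coord V I y i v) (y i) \<in> carrier V" if "i \<in> I" for i
    using basis_family_closed[OF V y that] by (rule scl_closed[OF V])
  have "f v = f (\<Sum>i\<in>I. scl V (coord V I y i v) (y i))"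
    by (rule arg_cong[of v _ f]) (rule coord_expansion[OF V y fin v])
  also have "\<dots> = (\<Sum>i\<in>I. f (scl V (coord V I y i v) (y i)))"
    by (rule lin_map_sum_family[OF V W f c])
  also have "\<dots> = (\<Sum>i\<in>I. scl W (coord V I y i v) (f (y i)))"
    by (intro sum.cong refl lin_map_scl[OF f] basis_family_closed[OF V y])
  finally show ?thesis .
qed

lemma lin_map_eq_on_basis:
  assumes V: "is_vec_space V" and W: "is_vec_space W" and fin: "finite I" and y: "basis_family V I y"
    and f: "lin_map V W f" and h: "lin_map V W h"
    and eq: "\<And>i. i \<in> I \<Longrightarrow> f (y i) = h (y i)" and v: "v \<in> carrier V"
  shows "f v = h v"
  unfolding lin_map_expansion[OF V W fin y f v] lin_map_expansion[OF V W fin y h v]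
  by (simp add: eq)

lemma tensor_eq_on_basis:
  assumes V: "is_vec_space V" and U: "is_vec_space U" and fin: "finite I" and y: "basis_family V I y"
    and f: "lin_map (V \<otimes>\<^sub>V V) U f" and h: "lin_map (V \<otimes>\<^sub>V V) U h"
    and eq: "\<And>i j. i \<in> I \<Longrightarrow> j \<in> I \<Longrightarrow> f (tens V V (y i) (y j)) = h (tens V V (y i) (y j))"
    and t: "t \<in> carrier (V \<otimes>\<^sub>V V)"
  shows "f t = h t"
proof (rule lin_map_tensor_unique[OF U f h _ t])
  fix v w assume v: "v \<in> carrier V" and w: "w \<in> carrier V"
  have "f (tens V V (y i) w) = h (tens V V (y i) w)" if i: "i \<in> I" for i
  proof -
    note r = lin_map_tens_right[OF basis_family_closed[OF V y i]]
    show ?thesis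
      by (rule lin_map_eq_on_basis[OF V U fin y lin_map_compose[OF r f] lin_map_compose[OF r h]
          eq[OF i] w])
  qed
  then show "f (tens V V v w) = h (tens V V v w)"
    by (rule lin_map_eq_on_basis[OF V U fin y lin_map_compose[OF lin_map_tens_left[OF w] f]
        lin_map_compose[OF lin_map_tens_left[OF w] h] _ v])
qed

lemma GL_carrier:
  "f \<in> carrier (GL V) \<longleftrightarrow> f \<in> extensional (carrier V) \<and> bij_betw f (carrier V) (carrier V) \<and> lin_map V V f"
  by (auto simp: GL_def Bij_def)

lemma group_type_basis_braiding:
  assumes V: "is_vec_space V" and lc: "lin_map (V \<otimes>\<^sub>V V) (V \<otimes>\<^sub>V V) c"
    and gt: "group_type_basis V c n y g" and i: "i \<in> {1..n}" and w: "w \<in> carrier V"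
  shows "c (tens V V (y i) w) = tens V V (g i w) (y i)"
proof (rule lin_map_eq_on_basis[OF V is_vec_space_tensor_prod _ _ _ _ _ w])
  show y: "basis_family V {1..n} y" using gt by (simp add: group_type_basis_def)
  have yi: "y i \<in> carrier V" using basis_family_closed[OF V y i] .
  show "lin_map V (V \<otimes>\<^sub>V V) (\<lambda>w. c (tens V V (y i) w))"
    by (rule lin_map_compose[OF lin_map_tens_right[OF yi] lc])
  have "lin_map V V (g i)" using gt i by (simp add: group_type_basis_def GL_carrier)
  from lin_map_compose[OF this lin_map_tens_left[OF yi]]
  show "lin_map V (V \<otimes>\<^sub>V V) (\<lambda>w. tens V V (g i w) (y i))" .
qed (use gt i in \<open>auto simp: group_type_basis_def\<close>)

text \<open>
  On \<open>y i \<otimes> y j \<otimes> y k\<close>, both sides of the braid equation can be evaluated up to the last braiding on the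
  left, and both have \<open>y i\<close> as their third factor.
\<close>

lemma braid_equation_group_type:
  assumes bp: "braided_pair V c" and gt: "group_type_basis V c n y g"
    and i: "i \<in> {1..n}" and j: "j \<in> {1..n}" and k: "k \<in> {1..n}"
  shows "c (tens V V (g i (y j)) (g i (y k))) = tens V V (g i (g j (y k))) (g i (y j))"
proof -
  have V: "is_vec_space V" and lc: "lin_map (V \<otimes>\<^sub>V V) (V \<otimes>\<^sub>V V) c" and be: "braid_equation V c"
    using bp by (auto simp: braided_pair_def)
  have y: "basis_family V {1..n} y" using gt by (simp add: group_type_basis_def)
  note VV = is_vec_space_tensor_prod[of V V]
  note braid = group_type_basis_braiding[OF V lc gt]
  note yc = basis_family_closed[OF V y]
  have gc: "g i v \<in> carrier V" if "i \<in> {1..n}" "v \<in> carrier V" for i v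
    using gt that lin_map_closed[of V V "g i" v] by (auto simp: group_type_basis_def GL_carrier)
  let ?VVV = "(V \<otimes>\<^sub>V V) \<otimes>\<^sub>V V" and ?\<alpha> = "assoc_map V V V"
  define c1 where "c1 = tensor_map (V \<otimes>\<^sub>V V) V (V \<otimes>\<^sub>V V) V c id"
  define c2 where
    "c2 = (\<lambda>t. inv_into (carrier ?VVV) ?\<alpha> (tensor_map V (V \<otimes>\<^sub>V V) V (V \<otimes>\<^sub>V V) id c (?\<alpha> t)))"
  let ?T = "\<lambda>u v w. tens (V \<otimes>\<^sub>V V) V (tens V V u v) w"
  have c1: "c1 (?T u v w) = tens (V \<otimes>\<^sub>V V) V (c (tens V V u v)) w"
    if "u \<in> carrier V" "v \<in> carrier V" "w \<in> carrier V" for u v w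
    using that by (simp add: c1_def tensor_map_tens[OF VV V lc lin_map_id] tens_in_carrier)
  have c2: "c2 (?T u v w) = ?T u v' w'"
    if "u \<in> carrier V" "v \<in> carrier V" "w \<in> carrier V" "v' \<in> carrier V" "w' \<in> carrier V"
      and "c (tens V V v w) = tens V V v' w'" for u v w v' w'
  proof -
    have "tensor_map V (V \<otimes>\<^sub>V V) V (V \<otimes>\<^sub>V V) id c (?\<alpha> (?T u v w)) = ?\<alpha> (?T u v' w')"
      using that
      by (simp add: assoc_map_tens[OF V V V] tensor_map_tens[OF V VV lin_map_id lc] tens_in_carrier)
    moreover have "?T u v' w' \<in> carrier ?VVV"
      using that by (intro tens_in_carrier)
    ultimately show ?thesis
      unfolding c2_def by (simp add: inv_into_f_f[OF inj_on_assoc_map[OF V V V]])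
  qed
  let ?t = "?T (y i) (y j) (y k)"
  have "c1 (c2 (c1 ?t)) = tens (V \<otimes>\<^sub>V V) V (c (tens V V (g i (y j)) (g i (y k)))) (y i)"
    using i j k by (simp add: c1 c2[where v' = "g i (y k)" and w' = "y i"] braid yc gc)
  moreover have "c2 (c1 (c2 ?t)) = ?T (g i (g j (y k))) (g i (y j)) (y i)"
    using i j k by (simp add: c1 c2[where v' = "g j (y k)" and w' = "y j"]
        c2[where v' = "g i (y j)" and w' = "y i"] braid yc gc)
  moreover have "?t \<in> carrier ?VVV" using i j k yc by (intro tens_in_carrier)
  then have "c1 (c2 (c1 ?t)) = c2 (c1 (c2 ?t))"
    using be unfolding braid_equation_def Let_def c1_def c2_def by blast
  ultimately have eq: "tens (V \<otimes>\<^sub>V V) V (c (tens V V (g i (y j)) (g i (y k)))) (y i)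
      = ?T (g i (g j (y k))) (g i (y j)) (y i)" by simp
  interpret VV: vector_space "scl (V \<otimes>\<^sub>V V)" using VV by (rule vec_space_subspace)
  \<comment> \<open>Slicing with the \<open>i\<close>-th coordinate removes the common last factor \<open>y i\<close>.\<close>
  obtain h where h: "\<And>v w. v \<in> carrier (V \<otimes>\<^sub>V V) \<Longrightarrow> w \<in> carrier V \<Longrightarrow>
      h (tens (V \<otimes>\<^sub>V V) V v w) = scl (V \<otimes>\<^sub>V V) (coord V {1..n} y i w) v"
    using contract_right[OF VV V lin_map_coord[OF V y]] by metis
  show ?thesis
    using arg_cong[OF eq, of h] i j k
    by (simp add: h yc gc tens_in_carrier lin_map_closed[OF lc] coord_basis[OF V y]
        del: One_nat_def)
qed

text \<open>
  Expanding \<open>g i (y j)\<close> in the basis and comparing coefficients: if \<open>y a\<close> occurs in \<open>g i (y j)\<close>, then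
  \<open>g a\<close> is the conjugate of \<open>g j\<close> by \<open>g i\<close>.
\<close>

lemma group_type_support:
  assumes bp: "braided_pair V c" and gt: "group_type_basis V c n y g"
    and i: "i \<in> {1..n}" and j: "j \<in> {1..n}" and a: "a \<in> {1..n}"
    and supp: "coord V {1..n} y a (g i (y j)) \<noteq> 0" and w: "w \<in> carrier V"
  shows "g a (g i w) = g i (g j w)"
proof (rule lin_map_eq_on_basis[OF _ _ _ _ _ _ _ w])
  show V: "is_vec_space V" and V': "is_vec_space V" using bp by (auto simp: braided_pair_def)
  show y: "basis_family V {1..n} y" using gt by (simp add: group_type_basis_def)
  have lg: "lin_map V V (g i)" if "i \<in> {1..n}" for i
    using gt that by (auto simp: group_type_basis_def GL_carrier)
  show "lin_map V V (\<lambda>w. g a (g i w))" "lin_map V V (\<lambda>w. g i (g j w))"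
    by (intro lin_map_compose[OF lg lg] i j a)+
  fix k assume k: "k \<in> {1..n}"
  have lc: "lin_map (V \<otimes>\<^sub>V V) (V \<otimes>\<^sub>V V) c" using bp by (auto simp: braided_pair_def)
  note yc = basis_family_closed[OF V y]
  note gc = lin_map_closed[OF lg]
  interpret vector_space "scl V" using V by (rule vec_space_subspace)
  let ?t = "\<lambda>b. coord V {1..n} y b (g i (y j))" and ?w = "g i (y k)"
  have w: "?w \<in> carrier V" using gc yc i k by blast
  obtain h where lh: "lin_map (V \<otimes>\<^sub>V V) V h" and h: "\<And>v w. v \<in> carrier V \<Longrightarrow> w \<in> carrier V \<Longrightarrow>
      h (tens V V v w) = scl V (coord V {1..n} y a w) v"
    using contract_right[OF V V lin_map_coord[OF V y]] by metis
  have "lin_map V V (\<lambda>v. h (c (tens V V v ?w)))"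
    by (rule lin_map_compose[OF lin_map_compose[OF lin_map_tens_left[OF w] lc] lh])
  from lin_map_expansion[OF V V finite_atLeastAtMost y this]
  have "h (c (tens V V (g i (y j)) ?w)) = (\<Sum>b\<in>{1..n}. scl V (?t b) (h (c (tens V V (y b) ?w))))"
    using gc yc i j by blast
  also have "\<dots> = (\<Sum>b\<in>{1..n}. if b = a then scl V (?t a) (g a ?w) else 0)"
    using a w
    by (intro sum.cong refl)
       (auto simp: group_type_basis_braiding[OF V lc gt] h gc yc coord_basis[OF V y] simp del: One_nat_def)
  also have "\<dots> = scl V (?t a) (g a ?w)" using a by simp
  finally have "h (c (tens V V (g i (y j)) ?w)) = scl V (?t a) (g a ?w)" .
  moreover have "h (c (tens V V (g i (y j)) ?w)) = scl V (?t a) (g i (g j (y k)))"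
    unfolding braid_equation_group_type[OF bp gt i j k] using i j k by (simp add: h gc yc)
  ultimately have "scl V (?t a) (g a ?w) = scl V (?t a) (g i (g j (y k)))" by metis
  then show "g a (g i (y k)) = g i (g j (y k))" using supp by simp
qed simp


lemma linear_if_lin_map:
  assumes "vector_space s" "V = \<lparr>carrier = UNIV, scl = s\<rparr>" "lin_map V V f"
  shows "Vector_Spaces.linear s s f"
  using assms
  by (simp add: Vector_Spaces.linear_def module_hom_def module_hom_axioms_def module_iff_vector_space
      lin_map_def)

lemma conjugating_family_group_type:
  assumes vs: "vector_space s" and V: "V = \<lparr>carrier = UNIV, scl = s\<rparr>"
    and bp: "braided_pair V c" and gt: "group_type_basis V c n y g"
  shows "conjugating_family s {1..n} y g"
proof -
  interpret vector_space s by (rule vs)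
  have vV: "is_vec_space V" using bp by (simp add: braided_pair_def)
  have y: "basis_family V {1..n} y" using gt by (simp add: group_type_basis_def)
  have lg: "lin_map V V (g i)" "bij (g i)" if "i \<in> {1..n}" for i
    using gt that by (auto simp: group_type_basis_def GL_carrier V)
  show ?thesis
  proof (intro conjugating_family.intro conjugating_family_axioms.intro vs)
    show "inj_on y {1..n}" "independent (y ` {1..n})" "span (y ` {1..n}) = UNIV"
      using y by (auto simp: basis_family_def V)
    fix i assume i: "i \<in> {1..n}"
    show "Vector_Spaces.linear s s (g i)" using lg(1)[OF i] by (rule linear_if_lin_map[OF vs V])
    show "bij (g i)" by (rule lg(2)[OF i])
    fix j assume j: "j \<in> {1..n}"
    let ?t = "\<lambda>a. coord V {1..n} y a (g i (y j))"
    have "s (?t a) (y a) \<in> span (y ` {a \<in> {1..n}. g a \<circ> g i = g i \<circ> g j})" if "a \<in> {1..n}" for a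
    proof (cases "?t a = 0")
      case False
      have "g a \<circ> g i = g i \<circ> g j"
        using group_type_support[OF bp gt i j that False] by (auto simp: V fun_eq_iff)
      with that show ?thesis by (intro span_scale span_base) auto
    qed (simp add: span_zero)
    then have "(\<Sum>a\<in>{1..n}. s (?t a) (y a)) \<in> span (y ` {a \<in> {1..n}. g a \<circ> g i = g i \<circ> g j})"
      by (rule span_sum)
    then show "g i (y j) \<in> span (y ` {a \<in> {1..n}. g a \<circ> g i = g i \<circ> g j})"
      using coord_expansion[OF vV y finite_atLeastAtMost, of "g i (y j)"] by (simp add: V)
  qed simp
qed

text \<open>
  Only stability under inverses has content: the set-theoretic inverse of a bijective linear map is
  linear.
\<close>

lemma group_GL:
  assumes V: "is_vec_space V"
  shows "group (GL V)"
proof -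
  let ?B = "BijGroup (carrier V)" and ?H = "{f \<in> Bij (carrier V). lin_map V V f}"
  interpret B: group ?B by (rule group_BijGroup)
  note clos = add_closed[OF V] scl_closed[OF V]
  have "subgroup ?H ?B"
  proof (rule B.subgroupI)
    show "?H \<subseteq> carrier ?B" by (auto simp: BijGroup_def)
    have "(\<lambda>x\<in>carrier V. x) \<in> ?H" by (auto simp: id_Bij lin_map_def clos)
    then show "?H \<noteq> {}" by blast
    fix f assume f: "f \<in> ?H"
    then have bf: "bij_betw f (carrier V) (carrier V)" and lf: "lin_map V V f"
      by (auto simp: Bij_def)
    let ?i = "inv_into (carrier V) f"
    have ic: "?i v \<in> carrier V" and fi: "f (?i v) = v" if "v \<in> carrier V" for v
      using bf that by (auto simp: bij_betw_def inv_into_into f_inv_into_f)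
    have i: "?i v = u" if "u \<in> carrier V" "f u = v" for u v
      using bf that by (auto simp: bij_betw_def)
    have "lin_map V V ?i"
      unfolding lin_map_def
      by (auto simp: ic fi clos lin_map_add[OF lf] lin_map_scl[OF lf] intro!: i)
    then have "lin_map V V (\<lambda>x\<in>carrier V. ?i x)"
      by (rule lin_map_cong[OF V]) simp
    then show "inv\<^bsub>?B\<^esub> f \<in> ?H" using f by (auto simp: inv_BijGroup restrict_inv_into_Bij)
    fix h assume h: "h \<in> ?H"
    have "lin_map V V (\<lambda>x. f (h x))" using f h by (auto intro: lin_map_compose)
    then have "lin_map V V (compose (carrier V) f h)"
      by (rule lin_map_cong[OF V]) (simp add: compose_def)
    then show "f \<otimes>\<^bsub>?B\<^esub> h \<in> ?H" using f h by (auto simp: BijGroup_def compose_Bij)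
  qed
  then show ?thesis unfolding GL_def by (rule subgroup.subgroup_is_group) (rule B.is_group)
qed

lemma (in group) subgroup_centralizer:
  assumes "T \<subseteq> carrier G"
  shows "subgroup {x \<in> carrier G. \<forall>t\<in>T. x \<otimes> t = t \<otimes> x} G"
proof (rule subgroupI)
  let ?C = "{x \<in> carrier G. \<forall>t\<in>T. x \<otimes> t = t \<otimes> x}"
  show "?C \<noteq> {}" using assms by (auto intro!: exI[of _ \<one>])
  fix x assume x: "x \<in> ?C"
  show "inv x \<in> ?C"
  proof (intro CollectI conjI ballI)
    fix t assume "t \<in> T"
    then have t: "t \<in> carrier G" "x \<otimes> t = t \<otimes> x" using assms x by auto
    then have "t = inv x \<otimes> (t \<otimes> x)" using x by (simp add: inv_solve_left)
    then show "inv x \<otimes> t = t \<otimes> inv x" using t x by (simp add: inv_solve_right m_assoc)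
  qed (use x in simp)
  fix z assume z: "z \<in> ?C"
  show "x \<otimes> z \<in> ?C"
  proof (intro CollectI conjI ballI)
    fix t assume "t \<in> T"
    then have t: "t \<in> carrier G" "x \<otimes> t = t \<otimes> x" "z \<otimes> t = t \<otimes> z" using assms x z by auto
    have "(x \<otimes> z) \<otimes> t = x \<otimes> (t \<otimes> z)" using t x z by (simp add: m_assoc)
    also have "\<dots> = (t \<otimes> x) \<otimes> z" using t x z by (simp add: m_assoc[symmetric])
    finally show "(x \<otimes> z) \<otimes> t = t \<otimes> (x \<otimes> z)" using t x z by (simp add: m_assoc)
  qed (use x z in simp)
qed auto

text \<open>
  Centralizers are subgroups, so whatever centralizes generators centralizes what they generate.
  Using this twice passes from \<open>S\<close> to the generated subgroup first in one argument of the
  commutator, then in the other.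
\<close>

lemma (in group) comm_group_subgroup_generated:
  assumes S: "S \<subseteq> carrier G" and comm: "\<And>x z. x \<in> S \<Longrightarrow> z \<in> S \<Longrightarrow> x \<otimes> z = z \<otimes> x"
  shows "comm_group (subgroup_generated G S)"
proof -
  let ?C = "\<lambda>T. {x \<in> carrier G. \<forall>t\<in>T. x \<otimes> t = t \<otimes> x}" and ?G = "generate G S"
  have "?G \<subseteq> ?C S"
    using S comm by (intro generate_subgroup_incl[OF _ subgroup_centralizer]) auto
  then have "S \<subseteq> ?C ?G" using S by auto
  moreover have "?G \<subseteq> carrier G" using S by (rule generate_incl)
  ultimately have "?G \<subseteq> ?C ?G"
    by (intro generate_subgroup_incl[OF _ subgroup_centralizer])
  moreover have "carrier (subgroup_generated G S) = ?G"
    using S by (simp add: carrier_subgroup_generated Int_absorb1)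
  ultimately show ?thesis
    by (intro group.group_comm_groupI group_subgroup_generated) auto
qed

lemma abelian_group_type_if_commuting:
  assumes V: "is_vec_space V" and gt: "group_type_basis V c n y g"
    and comm: "\<forall>i\<in>{1..n}. \<forall>j\<in>{1..n}. g i \<circ> g j = g j \<circ> g i"
  shows "abelian_group_type V c"
proof -
  interpret group "GL V" by (rule group_GL[OF V])
  have "f \<otimes>\<^bsub>GL V\<^esub> h = h \<otimes>\<^bsub>GL V\<^esub> f" if "f \<in> g ` {1..n}" "h \<in> g ` {1..n}" for f h
  proof -
    have "f \<in> Bij (carrier V)" "h \<in> Bij (carrier V)"
      using gt that by (auto simp: group_type_basis_def GL_def)
    moreover have "f \<circ> h = h \<circ> f" using comm that by auto
    ultimately show ?thesis
      by (auto simp: GL_def BijGroup_def compose_def fun_eq_iff)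
  qed
  moreover have "g ` {1..n} \<subseteq> carrier (GL V)" using gt by (auto simp: group_type_basis_def)
  ultimately have "comm_group (subgroup_generated (GL V) (g ` {1..n}))"
    by (intro comm_group_subgroup_generated)
  with gt show ?thesis unfolding abelian_group_type_def by blast
qed

text \<open>
  A braiding of group type whose operators satisfy the conjugation relations. Both a braided pair of
  group type and a Yetter--Drinfeld module give rise to this situation.
\<close>

locale group_type_braiding = conjugating_family scale I y g
  for scale :: "'a::field \<Rightarrow> 'b::ab_group_add \<Rightarrow> 'b" and I :: "'i set" and y g +
  fixes V :: "('a, 'b) vec_space" and c
  assumes V_eq: "V = \<lparr>carrier = UNIV, scl = scale\<rparr>"
    and lin_c: "lin_map (V \<otimes>\<^sub>V V) (V \<otimes>\<^sub>V V) c"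
    and braiding: "\<And>i w. i \<in> I \<Longrightarrow> c (tens V V (y i) w) = tens V V (g i w) (y i)"
begin

lemma is_vec_space: "is_vec_space V"
  by (simp add: is_vec_space_def V_eq vector_space_axioms)

lemma tens_scale:
  shows "tens V V (scale r v) w = scl (V \<otimes>\<^sub>V V) r (tens V V v w)"
    and "tens V V v (scale r w) = scl (V \<otimes>\<^sub>V V) r (tens V V v w)"
  using lin_map_scl[OF lin_map_tens_left[of w V V], of v r]
    lin_map_scl[OF lin_map_tens_right[of v V V], of w r] by (simp_all add: V_eq)

text \<open>
  The formula \<open>c (v \<otimes> w) = g i w \<otimes> v\<close> is linear in \<open>v\<close>, so it passes from the basis vectors that share
  the operator \<open>g i\<close> to their linear combinations. Hence a basis may be replaced by another one
  inside these spans without changing the shape of the braiding.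
\<close>

lemma braiding_span:
  assumes i: "i \<in> I" and v: "v \<in> span (y ` {a \<in> I. g a = g i})"
  shows "c (tens V V v w) = tens V V (g i w) v"
  using v
proof (induction rule: span_induct)
  case (step v)
  then show ?case using braiding by auto
next
  case base
  have car: "carrier V = UNIV" "scl V = scale" by (simp_all add: V_eq)
  have l: "lin_map V (V \<otimes>\<^sub>V V) (\<lambda>v. c (tens V V v w))" "lin_map V (V \<otimes>\<^sub>V V) (tens V V (g i w))"
    by (auto intro!: lin_map_compose[OF lin_map_tens_left lin_c] lin_map_tens_right simp: car)
  note T = is_vec_space_tensor_prod[of V V]
  show ?case
    unfolding subspace_def
    using lin_map_zero[OF is_vec_space T l(1)] lin_map_zero[OF is_vec_space T l(2)]
      lin_map_add[OF l(1)] lin_map_add[OF l(2)] lin_map_scl[OF l(1)] lin_map_scl[OF l(2)]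
    by (simp add: car)
qed

lemma basis_family_if_span:
  assumes "finite J" "card J = card I" "span (x ` J) = UNIV"
  shows "basis_family V J x"
proof -
  have "card I = dim UNIV"
    using dim_eq_card[of "y ` I" UNIV] basis by (simp add: card_image)
  then show ?thesis
    using assms spanning_family_is_basis[of J x] by (simp add: basis_family_def V_eq)
qed

lemma noncommuting_basis:
  assumes card: "card I = 3" and nc: "\<not> (\<forall>i\<in>I. \<forall>j\<in>I. g i \<circ> g j = g j \<circ> g i)"
  obtains x :: "3 \<Rightarrow> 'b" and q where "q \<noteq> 0" "basis_family V UNIV x"
    "\<And>a b. c (tens V V (x a) (x b)) = scl (V \<otimes>\<^sub>V V) q (tens V V (x (- a - b)) (x a))"
    "\<exists>i\<in>I. g i (x 0) = scale q (x 0)"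
proof -
  obtain \<sigma> :: "3 \<Rightarrow> 'i" and \<mu> q where \<sigma>: "bij_betw \<sigma> UNIV I" and q: "q \<noteq> 0" and \<mu>: "\<And>a. \<mu> a \<noteq> 0"
    and act: "\<And>a b. g (\<sigma> a) (scale (\<mu> b) (y (\<sigma> b)))
       = scale q (scale (\<mu> (- a - b)) (y (\<sigma> (- a - b))))"
    by (rule noncommuting_normal_form[OF card nc]) (rule that)
  define x where "x a = scale (\<mu> a) (y (\<sigma> a))" for a
  have I: "\<sigma> a \<in> I" for a using \<sigma> by (auto simp: bij_betw_def)
  have "y i \<in> span (range x)" if i: "i \<in> I" for i
  proof -
    obtain a where "i = \<sigma> a" using i bij_betw_imp_surj_on[OF \<sigma>] by blast
    then have "y i = scale (1 / \<mu> a) (x a)" by (simp add: x_def \<mu>)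
    then show ?thesis by (simp add: span_scale span_base)
  qed
  then have "span (y ` I) \<subseteq> span (range x)" by (intro span_minimal subspace_span) auto
  then have bf: "basis_family V UNIV x"
    using card basis(3) by (intro basis_family_if_span) auto
  have cx: "c (tens V V (x a) (x b)) = scl (V \<otimes>\<^sub>V V) q (tens V V (x (- a - b)) (x a))" for a b
  proof -
    have "x a \<in> span (y ` {b \<in> I. g b = g (\<sigma> a)})"
      unfolding x_def using I by (intro span_scale span_base) auto
    then show ?thesis
      using braiding_span[OF I] act by (simp add: tens_scale flip: x_def)
  qed
  have "g (\<sigma> 0) (x 0) = scale q (x 0)" using act[of 0 0] by (simp add: x_def)
  then have "\<exists>i\<in>I. g i (x 0) = scale q (x 0)" using I by (rule bexI)
  with q bf cx show thesis by (rule that)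
qed

text \<open>
  In a joint eigenbasis of the operators the vector \<open>g i (x b)\<close> is a multiple of \<open>x b\<close>, so the braiding
  becomes diagonal, with eigenvalues of the operators as coefficients.
\<close>

lemma commuting_basis:
  assumes card: "card I = CARD('j::finite)"
    and roots: "card {z :: 'a. z ^ N = 1} = N" "(of_nat N :: 'a) \<noteq> 0"
    and comm: "\<forall>i\<in>I. \<forall>j\<in>I. g i \<circ> g j = g j \<circ> g i"
    and order: "\<And>i. i \<in> I \<Longrightarrow> g i ^^ N = id"
  obtains x :: "'j::finite \<Rightarrow> 'b" and q where "basis_family V UNIV x" "\<And>a b. q a b ^ N = 1"
    "\<And>a b. c (tens V V (x a) (x b)) = scl (V \<otimes>\<^sub>V V) (q a b) (tens V V (x b) (x a))"
proof -
  obtain B where B: "independent B" "span B = UNIV"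
    and eig: "\<And>b. b \<in> B \<Longrightarrow> \<exists>i\<in>I. b \<in> span (y ` {a \<in> I. g a = g i}) \<and>
      (\<forall>j\<in>I. \<exists>z. z ^ N = 1 \<and> g j b = scale z b)"
    by (rule commuting_eigenbasis[OF roots comm order]) (assumption, rule that)
  have "card B = card I"
    using dim_eq_card[of B UNIV] dim_eq_card[of "y ` I" UNIV] B basis by (simp add: card_image)
  then have cB: "card B = CARD('j::finite)" "finite B"
    using card by (auto intro: card_ge_0_finite)
  obtain x :: "'j::finite \<Rightarrow> 'b" where x: "bij_betw x UNIV B"
    using finite_same_card_bij[of "UNIV :: 'j::finite set" B] cB by auto
  then have xB: "x a \<in> B" for a by (auto simp: bij_betw_def)
  have bf: "basis_family V UNIV x" using x B by (simp add: basis_family_def bij_betw_def V_eq)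
  have "\<exists>z. z ^ N = 1 \<and> c (tens V V (x a) (x b)) = scl (V \<otimes>\<^sub>V V) z (tens V V (x b) (x a))" for a b
  proof -
    obtain i where i: "i \<in> I" "x a \<in> span (y ` {a \<in> I. g a = g i})" using eig[OF xB[of a]] by blast
    obtain z where "z ^ N = 1" "g i (x b) = scale z (x b)" using eig[OF xB[of b]] i(1) by blast
    then show ?thesis using braiding_span[OF i] by (auto simp: tens_scale)
  qed
  then obtain q where "\<And>a b. q a b ^ N = 1 \<and>
      c (tens V V (x a) (x b)) = scl (V \<otimes>\<^sub>V V) (q a b) (tens V V (x b) (x a))" by metis
  with bf show thesis by (intro that) auto
qed

end

text \<open>Coordinates with respect to a basis in which \<open>c\<close> has the right form are the isomorphism.\<close>

lemma braided_iso_V3: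
  fixes V :: "('k::field, 'v::ab_group_add) vec_space" and x :: "3 \<Rightarrow> 'v"
  assumes V: "is_vec_space V" and lc: "lin_map (V \<otimes>\<^sub>V V) (V \<otimes>\<^sub>V V) c" and x: "basis_family V UNIV x"
    and c: "\<And>a b. c (tens V V (x a) (x b)) = scl (V \<otimes>\<^sub>V V) q (tens V V (x (- a - b)) (x a))"
  shows "braided_iso V c V3_space (V3_braiding q)"
proof -
  let ?S = "V3_space :: ('k, 3 \<Rightarrow> 'k) vec_space"
  define \<phi> where "\<phi> v = (\<lambda>a. coord V UNIV x a v)" for v
  interpret vector_space "scl V" using V by (rule vec_space_subspace)
  interpret F: vector_space "fscale :: 'k \<Rightarrow> (3 \<Rightarrow> 'k) \<Rightarrow> _" by (rule vector_space_fscale)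
  interpret G: vector_space "fscale :: 'k \<Rightarrow> ('k, 3 \<Rightarrow> 'k, 3 \<Rightarrow> 'k) tensor \<Rightarrow> _"
    by (rule vector_space_fscale)
  have S: "is_vec_space ?S" by (simp add: is_vec_space_def V3_space_def vector_space_fscale)
  have car: "carrier ?S = UNIV" "scl ?S = fscale" by (simp_all add: V3_space_def)
  note T = is_vec_space_tensor_prod
  have s: "scl (?S \<otimes>\<^sub>V ?S) = fscale" by (simp add: tensor_prod_def)
  note xc = basis_family_closed[OF V x UNIV_I]
  have lphi: "lin_map V ?S \<phi>"
    using lin_map_coord[OF V x] by (auto simp: lin_map_def car \<phi>_def base_field_def fscale_def fun_eq_iff)
  have phi_x: "\<phi> (x a) = V3_basis a" for a
    by (auto simp: \<phi>_def V3_basis_def fun_eq_iff coord_basis[OF V x])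
  have exp: "v = (\<Sum>a\<in>UNIV. scl V (\<phi> v a) (x a))" if "v \<in> carrier V" for v
    using coord_expansion[OF V x finite that] by (simp add: \<phi>_def)
  have "bij_betw \<phi> (carrier V) (carrier ?S)"
  proof (rule bij_betw_byWitness[where f' = "\<lambda>f. \<Sum>a\<in>UNIV. scl V (f a) (x a)"])
    have c: "(\<Sum>a\<in>UNIV. scl V (f a) (x a)) \<in> carrier V" for f
      by (intro sum_closed[OF V] scl_closed[OF V] xc)
    then show "(\<lambda>f. \<Sum>a\<in>UNIV. scl V (f a) (x a)) ` carrier ?S \<subseteq> carrier V" by auto
    have "\<phi> (\<Sum>a\<in>UNIV. scl V (f a) (x a)) = f" for f
    proof -
      have "\<phi> (\<Sum>a\<in>UNIV. scl V (f a) (x a)) = (\<Sum>a\<in>UNIV. fscale (f a) (V3_basis a))"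
        by (simp add: lin_map_sum_family[OF V S lphi] scl_closed[OF V] xc lin_map_scl[OF lphi]
            phi_x car)
      also have "\<dots> = f"
      proof
        fix b
        have "(\<Sum>a\<in>A. fscale (f a) (V3_basis a)) b = (\<Sum>a\<in>A. if a = b then f b else 0)" for A
          by (induction A rule: infinite_finite_induct) (auto simp: fscale_def V3_basis_def)
        then show "(\<Sum>a\<in>UNIV. fscale (f a) (V3_basis a)) b = f b" by simp
      qed
      finally show ?thesis .
    qed
    then show "\<forall>f\<in>carrier ?S. \<phi> (\<Sum>a\<in>UNIV. scl V (f a) (x a)) = f" by blast
  qed (use exp in \<open>auto simp: car\<close>)
  moreover have "tensor_map V V ?S ?S \<phi> \<phi> (c t) = V3_braiding q (tensor_map V V ?S ?S \<phi> \<phi> t)"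
    if "t \<in> carrier (V \<otimes>\<^sub>V V)" for t
  proof (rule tensor_eq_on_basis[OF V T finite x _ _ _ that])
    have l\<phi>\<phi>: "lin_map (V \<otimes>\<^sub>V V) (?S \<otimes>\<^sub>V ?S) (tensor_map V V ?S ?S \<phi> \<phi>)"
      by (rule lin_map_tensor_map[OF V V lphi lphi])
    let ?\<beta> = "\<lambda>v w :: 3 \<Rightarrow> 'k. \<Sum>i\<in>UNIV. \<Sum>j\<in>UNIV.
        fscale (v i * w j * q) (tens ?S ?S (V3_basis (- i - j)) (V3_basis i))"
    have "?\<beta> v w \<in> carrier (?S \<otimes>\<^sub>V ?S)" for v w
      unfolding s[symmetric]
      by (intro sum_closed[OF T] scl_closed[OF T] tens_in_carrier) (simp_all add: car)
    then have "bilin_map ?S ?S (?S \<otimes>\<^sub>V ?S) ?\<beta>"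
      unfolding bilin_map_def lin_map_def car s
      by (simp add: G.scale_sum_right sum.distrib[symmetric] G.scale_left_distrib[symmetric]
          distrib_left distrib_right) (simp add: fscale_def ac_simps)
    from lin_map_tensor_lift[OF S S T this]
    have lV3: "lin_map (?S \<otimes>\<^sub>V ?S) (?S \<otimes>\<^sub>V ?S) (V3_braiding q)" by (simp add: V3_braiding_def)
    show "lin_map (V \<otimes>\<^sub>V V) (?S \<otimes>\<^sub>V ?S) (\<lambda>t. tensor_map V V ?S ?S \<phi> \<phi> (c t))"
      by (rule lin_map_compose[OF lc l\<phi>\<phi>])
    show "lin_map (V \<otimes>\<^sub>V V) (?S \<otimes>\<^sub>V ?S) (\<lambda>t. V3_braiding q (tensor_map V V ?S ?S \<phi> \<phi> t))"
      by (rule lin_map_compose[OF l\<phi>\<phi> lV3])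
    fix a b
    show "tensor_map V V ?S ?S \<phi> \<phi> (c (tens V V (x a) (x b)))
        = V3_braiding q (tensor_map V V ?S ?S \<phi> \<phi> (tens V V (x a) (x b)))"
      by (simp add: c lin_map_scl[OF l\<phi>\<phi>] tens_in_carrier xc tensor_map_tens[OF V V lphi lphi]
          phi_x V3_braiding_basis)
  qed
  ultimately show ?thesis unfolding braided_iso_def using lphi by blast
qed

theorem group_type_dim3:
  assumes vs: "vector_space s" and dim: "vector_space.dim s (UNIV :: 'v::ab_group_add set) = 3"
    and V: "V = \<lparr>carrier = UNIV, scl = s\<rparr>"
    and bp: "braided_pair V c" and gt: "group_type V c"
  shows "abelian_group_type V c \<or> (\<exists>q. q \<noteq> 0 \<and> braided_iso V c V3_space (V3_braiding q))"
proof -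
  obtain n y g where gt: "group_type_basis V c n y g" using gt by (auto simp: group_type_def)
  have vV: "is_vec_space V" and lc: "lin_map (V \<otimes>\<^sub>V V) (V \<otimes>\<^sub>V V) c"
    using bp by (auto simp: braided_pair_def)
  interpret conjugating_family s "{1..n}" y g
    by (rule conjugating_family_group_type[OF vs V bp gt])
  interpret group_type_braiding s "{1..n}" y g V c
    by unfold_locales (rule V, rule lc, rule group_type_basis_braiding[OF vV lc gt], auto simp: V)
  have "local.dim UNIV = card (y ` {1..n})"
    using basis(2,3) by (intro dim_eq_card) simp_all
  then have card: "card {1..n} = 3"
    using basis(1) by (simp only: dim card_image)
  show ?thesis
  proof (cases "\<forall>i\<in>{1..n}. \<forall>j\<in>{1..n}. g i \<circ> g j = g j \<circ> g i")
    case True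
    then show ?thesis using abelian_group_type_if_commuting[OF vV gt] by blast
  next
    case False
    obtain x :: "3 \<Rightarrow> 'v" and q where "q \<noteq> 0" "basis_family V UNIV x"
      "\<And>a b. c (tens V V (x a) (x b)) = scl (V \<otimes>\<^sub>V V) q (tens V V (x (- a - b)) (x a))"
      by (rule noncommuting_basis[OF card False]) (rule that)
    then show ?thesis using braided_iso_V3[OF vV lc] by blast
  qed
qed

section \<open>Yetter--Drinfeld modules are graded\<close>

locale yetter_drinfeld_module = group \<Gamma>
  for \<Gamma> :: "('g, 'm) monoid_scheme" (structure) +
  fixes V :: "('k::field, 'v::ab_group_add) vec_space" and act and \<delta>
  assumes fin: "finite (carrier \<Gamma>)" and yd: "yetter_drinfeld \<Gamma> V act \<delta>"
begin

abbreviation H :: "('k, 'g \<Rightarrow> 'k) vec_space" where "H \<equiv> group_algebra \<Gamma>"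

abbreviation elem :: "'g \<Rightarrow> 'g \<Rightarrow> 'k" where "elem \<equiv> group_elem"

lemma vec_V: "is_vec_space V"
  using yd by (simp add: yetter_drinfeld_def)

lemma vec_H: "is_vec_space H"
proof -
  interpret vector_space "fscale :: 'k \<Rightarrow> ('g \<Rightarrow> 'k) \<Rightarrow> _" by (rule vector_space_fscale)
  show ?thesis
    by (simp add: is_vec_space_def group_algebra_def vector_space_fscale subspace_def) (simp add: fscale_def)
qed

lemma elem_closed: "g \<in> carrier \<Gamma> \<Longrightarrow> elem g \<in> carrier H"
  by (auto simp: group_algebra_def group_elem_def)

lemma lin_map_eval: "lin_map H base_field (\<lambda>a. a g)"
  by (simp add: lin_map_def group_algebra_def base_field_def fscale_def)

text \<open>
  Comultiplication, counit and product of the group algebra all have this shape: they extend a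
  prescription on the group elements linearly.
\<close>

lemma lin_map_group_sum:
  assumes W: "is_vec_space W" and t: "\<And>g. g \<in> carrier \<Gamma> \<Longrightarrow> t g \<in> carrier W"
  shows "lin_map H W (\<lambda>a. \<Sum>g\<in>carrier \<Gamma>. scl W (a g) (t g))"
    and "g \<in> carrier \<Gamma> \<Longrightarrow> (\<Sum>h\<in>carrier \<Gamma>. scl W (elem g h) (t h)) = t g"
proof -
  interpret vector_space "scl W" using W by (rule vec_space_subspace)
  show "lin_map H W (\<lambda>a. \<Sum>g\<in>carrier \<Gamma>. scl W (a g) (t g))"
    unfolding lin_map_def
    by (auto simp: group_algebra_def fscale_def scale_left_distrib sum.distrib scale_sum_right
        intro!: sum_closed[OF W] scl_closed[OF W] t)
  assume g: "g \<in> carrier \<Gamma>"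
  have "(\<Sum>h\<in>carrier \<Gamma>. scl W (elem g h) (t h)) = (\<Sum>h\<in>carrier \<Gamma>. if h = g then t h else 0)"
    by (intro sum.cong refl) (simp add: group_elem_def)
  then show "(\<Sum>h\<in>carrier \<Gamma>. scl W (elem g h) (t h)) = t g" using fin g by simp
qed

lemma scl_tensor: "scl (U \<otimes>\<^sub>V W) = fscale"
  by (simp add: tensor_prod_def)

lemma scl_H: "scl H = fscale"
  by (simp add: group_algebra_def)

lemma comult:
  shows lin_map_comult: "lin_map H (H \<otimes>\<^sub>V H) (ga_comult \<Gamma>)"
    and comult_elem: "g \<in> carrier \<Gamma> \<Longrightarrow> ga_comult \<Gamma> (elem g) = tens H H (elem g) (elem g)"
  using lin_map_group_sum[OF is_vec_space_tensor_prod, of "\<lambda>g. tens H H (elem g) (elem g)" H H]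
  by (simp_all add: ga_comult_def[abs_def] scl_tensor tens_in_carrier elem_closed)

lemma counit:
  shows lin_map_counit: "lin_map H base_field (ga_counit \<Gamma>)"
    and counit_elem: "g \<in> carrier \<Gamma> \<Longrightarrow> ga_counit \<Gamma> (elem g) = 1"
  using lin_map_group_sum[OF is_vec_space_base_field, of "\<lambda>_. 1"]
  by (simp_all add: ga_counit_def[abs_def] base_field_def)

lemma mult:
  shows bilin_map_mult: "bilin_map H H H (ga_mult \<Gamma>)"
    and mult_elem: "g \<in> carrier \<Gamma> \<Longrightarrow> h \<in> carrier \<Gamma> \<Longrightarrow>
      ga_mult \<Gamma> (elem g) (elem h) = elem (g \<otimes> h)"
proof -
  interpret vector_space "fscale :: 'k \<Rightarrow> ('g \<Rightarrow> 'k) \<Rightarrow> _" by (rule vector_space_fscale)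
  have eq: "ga_mult \<Gamma> a b
      = (\<Sum>g\<in>carrier \<Gamma>. fscale (a g) (\<Sum>h\<in>carrier \<Gamma>. fscale (b h) (elem (g \<otimes> h))))"
    and eq': "ga_mult \<Gamma> a b
      = (\<Sum>h\<in>carrier \<Gamma>. fscale (b h) (\<Sum>g\<in>carrier \<Gamma>. fscale (a g) (elem (g \<otimes> h))))" for a b :: "'g \<Rightarrow> 'k"
    unfolding ga_mult_def
    by (simp add: scale_sum_right, subst sum.swap, simp add: scale_sum_right mult.commute)
  note S = lin_map_group_sum[OF vec_H, unfolded scl_H]
  have c: "(\<Sum>h\<in>carrier \<Gamma>. fscale (b h) (elem (g \<otimes> h))) \<in> carrier H"
    "(\<Sum>h\<in>carrier \<Gamma>. fscale (b h) (elem (h \<otimes> g))) \<in> carrier H" if "g \<in> carrier \<Gamma>" for g b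
    using that unfolding scl_H[symmetric]
    by (auto intro!: sum_closed[OF vec_H] scl_closed[OF vec_H] elem_closed)
  show "bilin_map H H H (ga_mult \<Gamma>)"
    unfolding bilin_map_def
  proof (intro conjI ballI)
    fix a :: "'g \<Rightarrow> 'k"
    show "lin_map H H (ga_mult \<Gamma> a)" unfolding eq'[abs_def] by (rule S(1)) (rule c)
    show "lin_map H H (\<lambda>b. ga_mult \<Gamma> b a)" unfolding eq by (rule S(1)) (rule c)
  qed
  assume "g \<in> carrier \<Gamma>" "h \<in> carrier \<Gamma>"
  then show "ga_mult \<Gamma> (elem g) (elem h) = elem (g \<otimes> h)"
    unfolding eq by (simp add: S(2) elem_closed c)
qed

subsection \<open>The action\<close>

lemma bilin_map_act: "bilin_map H V V act"
  using yd by (simp add: yetter_drinfeld_def ga_module_def)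

lemma lin_map_act: "g \<in> carrier \<Gamma> \<Longrightarrow> lin_map V V (act (elem g))"
  by (rule bilin_map_right[OF bilin_map_act elem_closed])

lemma act_one: "v \<in> carrier V \<Longrightarrow> act (elem \<one>) v = v"
  using yd by (simp add: yetter_drinfeld_def ga_module_def)

lemma act_mult:
  assumes "g \<in> carrier \<Gamma>" "h \<in> carrier \<Gamma>" "v \<in> carrier V"
  shows "act (elem (g \<otimes> h)) v = act (elem g) (act (elem h) v)"
proof -
  have "act (ga_mult \<Gamma> (elem g) (elem h)) v = act (elem g) (act (elem h) v)"
    using yd assms elem_closed unfolding yetter_drinfeld_def ga_module_def by blast
  then show ?thesis using assms by (simp add: mult_elem)
qed

lemma act_pow:
  assumes g: "g \<in> carrier \<Gamma>" and v: "v \<in> carrier V"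
  shows "(act (elem g) ^^ n) v = act (elem (g [^] n)) v"
proof (induction n)
  case (Suc n)
  have "(act (elem g) ^^ Suc n) v = act (elem g) (act (elem (g [^] n)) v)" using Suc by simp
  also have "\<dots> = act (elem (g \<otimes> g [^] n)) v" using g v by (intro act_mult[symmetric]) auto
  also have "g \<otimes> g [^] n = g [^] Suc n" using g by (rule nat_pow_Suc2[symmetric])
  finally show ?case .
qed (simp add: act_one v)

lemma bij_betw_act:
  assumes g: "g \<in> carrier \<Gamma>"
  shows "bij_betw (act (elem g)) (carrier V) (carrier V)"
proof (rule bij_betw_byWitness[where f' = "act (elem (inv g))"])
  have c: "h \<in> carrier \<Gamma> \<Longrightarrow> v \<in> carrier V \<Longrightarrow> act (elem h) v \<in> carrier V" for h v
    by (rule lin_map_closed[OF lin_map_act])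
  show "act (elem g) ` carrier V \<subseteq> carrier V" "act (elem (inv g)) ` carrier V \<subseteq> carrier V"
    using g c by auto
  show "\<forall>v\<in>carrier V. act (elem (inv g)) (act (elem g) v) = v"
    "\<forall>v\<in>carrier V. act (elem g) (act (elem (inv g)) v) = v"
    using g by (simp_all add: act_mult[symmetric] act_one)
qed

subsection \<open>Homogeneous vectors\<close>

text \<open>
  For group-like \<open>g\<close>, the vectors with \<open>\<delta> v = g \<otimes> v\<close> form the part of degree \<open>g\<close> in the grading of \<open>V\<close>
  by \<open>\<Gamma>\<close> that the coaction encodes.
\<close>

definition homogeneous :: "'g \<Rightarrow> 'v \<Rightarrow> bool" where
  "homogeneous g v \<longleftrightarrow> g \<in> carrier \<Gamma> \<and> v \<in> carrier V \<and> \<delta> v = tens H V (elem g) v"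

lemma lin_map_coaction: "lin_map V (H \<otimes>\<^sub>V V) \<delta>"
  using yd by (simp add: yetter_drinfeld_def ga_comodule_def Let_def)

lemma tensor_group_expansion:
  assumes "t \<in> carrier (H \<otimes>\<^sub>V V)"
  shows "\<exists>u. (\<forall>g. u g \<in> carrier V) \<and> t = (\<Sum>g\<in>carrier \<Gamma>. tens H V (elem g) (u g))"
  using assms
proof (induction rule: tensor_prod_induct)
  case (tens a w)
  have "a = (\<Sum>g\<in>carrier \<Gamma>. fscale (a g) (elem g))"
  proof
    fix h
    have "(\<Sum>g\<in>A. fscale (a g) (elem g)) h = (\<Sum>g\<in>A. if g = h then a h else 0)" for A
      by (induction A rule: infinite_finite_induct) (auto simp: fscale_def group_elem_def)
    then show "a h = (\<Sum>g\<in>carrier \<Gamma>. fscale (a g) (elem g)) h"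
      using fin tens(1) by (auto simp: group_algebra_def)
  qed
  then have "tens H V a w = tens H V (\<Sum>g\<in>carrier \<Gamma>. fscale (a g) (elem g)) w" by (rule arg_cong)
  also have "\<dots> = (\<Sum>g\<in>carrier \<Gamma>. tens H V (scl H (a g) (elem g)) w)"
    unfolding scl_H[symmetric]
    by (rule lin_map_sum_family[OF vec_H is_vec_space_tensor_prod lin_map_tens_left[OF tens(2)]])
       (rule scl_closed[OF vec_H elem_closed])
  also have "\<dots> = (\<Sum>g\<in>carrier \<Gamma>. tens H V (elem g) (scl V (a g) w))"
    using tens(2)
    by (intro sum.cong refl)
       (simp add: lin_map_scl[OF lin_map_tens_left] lin_map_scl[OF lin_map_tens_right] elem_closed)
  finally show ?case using tens(2) scl_closed[OF vec_V] by (intro exI[of _ "\<lambda>g. scl V (a g) w"]) simp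
next
  case zero
  have "tens H V (elem g) 0 = 0" if "g \<in> carrier \<Gamma>" for g
    using lin_map_zero[OF vec_V is_vec_space_tensor_prod lin_map_tens_right[OF elem_closed[OF that]]] .
  then show ?case using zero_closed[OF vec_V] by (intro exI[of _ "\<lambda>_. 0"]) simp
next
  case (add s t)
  then obtain u u' where u: "\<forall>g. u g \<in> carrier V" "s = (\<Sum>g\<in>carrier \<Gamma>. tens H V (elem g) (u g))"
    "\<forall>g. u' g \<in> carrier V" "t = (\<Sum>g\<in>carrier \<Gamma>. tens H V (elem g) (u' g))" by blast
  have "s + t = (\<Sum>g\<in>carrier \<Gamma>. tens H V (elem g) (u g) + tens H V (elem g) (u' g))"
    unfolding u(2,4) by (rule sum.distrib[symmetric])
  also have "\<dots> = (\<Sum>g\<in>carrier \<Gamma>. tens H V (elem g) (u g + u' g))"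
    using u(1,3)
    by (intro sum.cong refl lin_map_add[OF lin_map_tens_right, symmetric] elem_closed) auto
  finally show ?case
    using u(1,3) by (intro exI[of _ "\<lambda>g. u g + u' g"] conjI allI add_closed[OF vec_V]) simp_all
next
  case (scale r t)
  then obtain u where u: "\<forall>g. u g \<in> carrier V" "t = (\<Sum>g\<in>carrier \<Gamma>. tens H V (elem g) (u g))"
    by blast
  interpret T: vector_space "scl (H \<otimes>\<^sub>V V)" using is_vec_space_tensor_prod by (rule vec_space_subspace)
  from u show ?case
    by (intro exI[of _ "\<lambda>g. scl V r (u g)"])
       (simp add: scl_closed[OF vec_V] lin_map_scl[OF lin_map_tens_right] elem_closed T.scale_sum_right)
qed

text \<open>
  Write \<open>\<delta> v = \<Sum>\<^sub>g g \<otimes> u g\<close>. The counit axiom gives \<open>v = \<Sum>\<^sub>g u g\<close>, and comparing the parts of the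
  coassociativity axiom with first factor \<open>g\<close> gives \<open>\<delta> (u g) = g \<otimes> u g\<close>.
\<close>

lemma homogeneous_decomposition:
  assumes v: "v \<in> carrier V"
  obtains u where "\<And>g. g \<in> carrier \<Gamma> \<Longrightarrow> homogeneous g (u g)" "v = (\<Sum>g\<in>carrier \<Gamma>. u g)"
proof -
  note T = is_vec_space_tensor_prod
  obtain u where u: "\<And>g. u g \<in> carrier V" and d: "\<delta> v = (\<Sum>g\<in>carrier \<Gamma>. tens H V (elem g) (u g))"
    using tensor_group_expansion[OF lin_map_closed[OF lin_map_coaction v]] by blast
  have tc: "tens H V (elem g) (u g) \<in> carrier (H \<otimes>\<^sub>V V)" if "g \<in> carrier \<Gamma>" for g
    using that by (intro tens_in_carrier elem_closed u)
  have push: "f (\<delta> v) = (\<Sum>g\<in>carrier \<Gamma>. f (tens H V (elem g) (u g)))"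
    if "is_vec_space W" "lin_map (H \<otimes>\<^sub>V V) W f" for f and W :: "('k, 'c::ab_group_add) vec_space"
    unfolding d by (rule lin_map_sum_family[OF T that tc])
  interpret vector_space "scl V" using vec_V by (rule vec_space_subspace)
  note cou = tensor_lift[OF vec_H vec_V vec_V bilin_map_functional_scale(1)[OF vec_V lin_map_counit]]
  have "v = tensor_lift H V V (\<lambda>a w. scl V (ga_counit \<Gamma> a) w) (\<delta> v)"
    using yd v by (simp add: yetter_drinfeld_def ga_comodule_def Let_def)
  also have "\<dots> = (\<Sum>g\<in>carrier \<Gamma>. u g)"
    by (simp add: push[OF vec_V cou(1)] cou(2) elem_closed u counit_elem)
  finally have sum: "v = (\<Sum>g\<in>carrier \<Gamma>. u g)" .
  have "homogeneous h (u h)" if h: "h \<in> carrier \<Gamma>" for h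
  proof -
    interpret HV: vector_space "scl (H \<otimes>\<^sub>V V)" using T by (rule vec_space_subspace)
    \<comment> \<open>\<open>p\<close> extracts the part with first factor \<open>h\<close>; the two sides of coassociativity become
      \<open>h \<otimes> u h\<close> and \<open>\<delta> (u h)\<close>.\<close>
    obtain p where lp: "lin_map (H \<otimes>\<^sub>V (H \<otimes>\<^sub>V V)) (H \<otimes>\<^sub>V V) p" and
      p: "\<And>a t. a \<in> carrier H \<Longrightarrow> t \<in> carrier (H \<otimes>\<^sub>V V) \<Longrightarrow>
        p (tens H (H \<otimes>\<^sub>V V) a t) = scl (H \<otimes>\<^sub>V V) (a h) t"
      using contract_left[OF vec_H T lin_map_eval] by blast
    have pe: "p (tens H (H \<otimes>\<^sub>V V) (elem g) t) = (if g = h then t else 0)"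
      if "g \<in> carrier \<Gamma>" "t \<in> carrier (H \<otimes>\<^sub>V V)" for g t
      using that by (auto simp: p elem_closed) (auto simp: group_elem_def)
    let ?L = "\<lambda>t. p (assoc_map H H V (tensor_map H V (H \<otimes>\<^sub>V H) V (ga_comult \<Gamma>) id t))"
    let ?R = "\<lambda>t. p (tensor_map H V H (H \<otimes>\<^sub>V V) id \<delta> t)"
    have "lin_map (H \<otimes>\<^sub>V V) (H \<otimes>\<^sub>V V) ?L"
      by (intro lin_map_compose[OF lin_map_compose[OF
            lin_map_tensor_map[OF vec_H vec_V lin_map_comult lin_map_id]
            lin_map_assoc_map[OF vec_H vec_H vec_V]] lp])
    from push[OF T this] have "?L (\<delta> v) = (\<Sum>g\<in>carrier \<Gamma>. if g = h then tens H V (elem g) (u g) else 0)"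
      by (simp add: tensor_map_tens[OF vec_H vec_V lin_map_comult lin_map_id] elem_closed u comult_elem
          assoc_map_tens[OF vec_H vec_H vec_V] pe tc cong: sum.cong)
    then have L: "?L (\<delta> v) = tens H V (elem h) (u h)" using fin h by simp
    have "lin_map (H \<otimes>\<^sub>V V) (H \<otimes>\<^sub>V V) ?R"
      by (intro lin_map_compose[OF lin_map_tensor_map[OF vec_H vec_V lin_map_id lin_map_coaction] lp])
    from push[OF T this] have "?R (\<delta> v) = (\<Sum>g\<in>carrier \<Gamma>. if g = h then \<delta> (u g) else 0)"
      by (simp add: tensor_map_tens[OF vec_H vec_V lin_map_id lin_map_coaction] elem_closed u
          pe lin_map_closed[OF lin_map_coaction] cong: sum.cong)
    then have R: "?R (\<delta> v) = \<delta> (u h)" using fin h by simp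
    have "?L (\<delta> v) = ?R (\<delta> v)"
      using yd v by (simp add: yetter_drinfeld_def ga_comodule_def Let_def)
    with L R show ?thesis by (simp add: homogeneous_def h u)
  qed
  with sum show thesis by (rule that[rotated])
qed

lemma homogeneous_act:
  assumes g: "g \<in> carrier \<Gamma>" and v: "homogeneous h v"
  shows "homogeneous (g \<otimes> h \<otimes> inv g) (act (elem g) v)"
proof -
  have h: "h \<in> carrier \<Gamma>" and vV: "v \<in> carrier V" and d: "\<delta> v = tens H V (elem h) v"
    using v by (auto simp: homogeneous_def)
  let ?conj = "\<lambda>a. ga_mult \<Gamma> (elem g) (ga_mult \<Gamma> a (elem (inv g)))"
  have "lin_map H H ?conj"
    using g by (intro lin_map_compose[OF bilin_map_left[OF bilin_map_mult] bilin_map_right[OF bilin_map_mult]]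
        elem_closed) simp_all
  note tm = tensor_map_tens[OF vec_H vec_V this lin_map_act[OF g]]
  have "\<delta> (act (elem g) v) = tensor_map H V H V ?conj (act (elem g)) (\<delta> v)"
    using yd g vV by (simp add: yetter_drinfeld_def)
  also have "\<dots> = tens H V (?conj (elem h)) (act (elem g) v)"
    unfolding d using h vV by (simp add: tm elem_closed)
  also have "?conj (elem h) = elem (g \<otimes> h \<otimes> inv g)"
    using g h by (simp add: mult_elem m_assoc)
  finally show ?thesis
    using g h vV by (simp add: homogeneous_def lin_map_closed[OF lin_map_act])
qed

text \<open>
  Slicing \<open>\<delta> w = h \<otimes> w\<close> at \<open>h\<close> discards the components of \<open>w\<close> along basis vectors of other degrees.
\<close>

lemma homogeneous_span:
  assumes w: "homogeneous h w" and B: "finite B" "\<And>b. b \<in> B \<Longrightarrow> homogeneous (grade b) b"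
    and exp: "w = (\<Sum>b\<in>B. scl V (t b) b)"
  shows "w \<in> module.span (scl V) {b \<in> B. grade b = h}"
proof -
  interpret vector_space "scl V" using vec_V by (rule vec_space_subspace)
  have bV: "b \<in> carrier V" and bd: "grade b \<in> carrier \<Gamma>" and d: "\<delta> b = tens H V (elem (grade b)) b"
    if "b \<in> B" for b using B(2)[OF that] by (auto simp: homogeneous_def)
  have h: "h \<in> carrier \<Gamma>" and wV: "w \<in> carrier V" and dw: "\<delta> w = tens H V (elem h) w"
    using w by (auto simp: homogeneous_def)
  obtain p where lp: "lin_map (H \<otimes>\<^sub>V V) V p" and
    p: "\<And>a v. a \<in> carrier H \<Longrightarrow> v \<in> carrier V \<Longrightarrow> p (tens H V a v) = scl V (a h) v"
    using contract_left[OF vec_H vec_V lin_map_eval] by blast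
  have l: "lin_map V V (\<lambda>v. p (\<delta> v))" by (rule lin_map_compose[OF lin_map_coaction lp])
  have "w = p (\<delta> w)" using h wV by (simp add: dw p elem_closed) (simp add: group_elem_def)
  also have "\<dots> = (\<Sum>b\<in>B. p (\<delta> (scl V (t b) b)))"
    unfolding exp by (rule lin_map_sum_family[OF vec_V vec_V l]) (rule scl_closed[OF vec_V bV])
  also have "\<dots> = (\<Sum>b\<in>B. scl V (t b) (if grade b = h then b else 0))"
    by (intro sum.cong refl)
       (auto simp: lin_map_scl[OF l] bV d p elem_closed bd, auto simp: group_elem_def)
  also have "\<dots> \<in> span {b \<in> B. grade b = h}"
    by (intro span_sum span_scale) (auto intro: span_base span_zero)
  finally show ?thesis .
qed

lemma yd_braiding:
  shows lin_map_yd_braiding: "lin_map (V \<otimes>\<^sub>V V) (V \<otimes>\<^sub>V V) (yd_braiding \<Gamma> V act \<delta>)"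
    and yd_braiding_homogeneous: "homogeneous g v \<Longrightarrow> w \<in> carrier V \<Longrightarrow>
      yd_braiding \<Gamma> V act \<delta> (tens V V v w) = tens V V (act (elem g) w) v"
proof -
  note T = is_vec_space_tensor_prod
  let ?\<beta> = "\<lambda>w a u. tens V V (act a w) u"
  have b: "bilin_map H V (V \<otimes>\<^sub>V V) (?\<beta> w)" if "w \<in> carrier V" for w
    using bilin_map_tens_compose[OF bilin_map_left[OF bilin_map_act that] lin_map_id] by simp
  have "bilin_map (H \<otimes>\<^sub>V V) V (V \<otimes>\<^sub>V V) (\<lambda>t w. tensor_lift H V (V \<otimes>\<^sub>V V) (?\<beta> w) t)"
    by (intro bilin_map_tensor_lift vec_H vec_V T b)
       (auto intro: lin_map_compose[OF bilin_map_right[OF bilin_map_act] lin_map_tens_left])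
  from bilin_map_compose[OF this lin_map_coaction lin_map_id lin_map_id]
  have bb: "bilin_map V V (V \<otimes>\<^sub>V V) (\<lambda>v w. tensor_lift H V (V \<otimes>\<^sub>V V) (?\<beta> w) (\<delta> v))" by simp
  note L = tensor_lift[OF vec_V vec_V T bb, folded yd_braiding_def]
  show "lin_map (V \<otimes>\<^sub>V V) (V \<otimes>\<^sub>V V) (yd_braiding \<Gamma> V act \<delta>)" by (rule L(1))
  show "homogeneous g v \<Longrightarrow> w \<in> carrier V \<Longrightarrow>
      yd_braiding \<Gamma> V act \<delta> (tens V V v w) = tens V V (act (elem g) w) v"
    by (simp add: L(2) homogeneous_def tensor_lift_tens[OF vec_H vec_V T b] elem_closed)
qed

end

context yetter_drinfeld_module
begin

lemma homogeneous_basis: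
  assumes vs: "vector_space s" and V_eq: "V = \<lparr>carrier = UNIV, scl = s\<rparr>"
  obtains B grade where "module.independent s B" "module.span s B = UNIV"
    "\<And>b. b \<in> B \<Longrightarrow> homogeneous (grade b) b"
proof -
  interpret vector_space s by (rule vs)
  let ?Z = "{v. \<exists>g. homogeneous g v}"
  obtain B where B: "B \<subseteq> ?Z" "independent B" "?Z \<subseteq> span B"
    by (rule maximal_independent_subset)
  have "v \<in> span B" for v
  proof -
    have "v \<in> carrier V" by (simp add: V_eq)
    then obtain u where u: "\<And>g. g \<in> carrier \<Gamma> \<Longrightarrow> homogeneous g (u g)" "v = (\<Sum>g\<in>carrier \<Gamma>. u g)"
      by (rule homogeneous_decomposition) (rule that)
    have "u g \<in> span B" if "g \<in> carrier \<Gamma>" for g using u(1)[OF that] B(3) by blast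
    then show ?thesis unfolding u(2) by (rule span_sum)
  qed
  then have span: "span B = UNIV" by blast
  have ex: "\<forall>b\<in>B. \<exists>g. homogeneous g b" using B(1) by blast
  obtain grade where "\<forall>b\<in>B. homogeneous (grade b) b" using bchoice[OF ex] by blast
  with B(2) span show thesis by (intro that) auto
qed

text \<open>
  A homogeneous basis turns the braiding into one of group type. The conjugation relations come from
  the compatibility of action and grading: \<open>g\<close> maps the part of degree \<open>h\<close> to the part of degree
  \<open>g h g\<^sup>-\<^sup>1\<close>, and degrees of this form act by the conjugate operator.
\<close>

lemma group_type_braiding_yd:
  assumes vs: "vector_space s" and V_eq: "V = \<lparr>carrier = UNIV, scl = s\<rparr>"
    and B: "finite B" "module.independent s B" "module.span s B = UNIV"
    and grade: "\<And>b. b \<in> B \<Longrightarrow> homogeneous (grade b) b"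
  shows "group_type_braiding s B (\<lambda>b. b) (\<lambda>b. act (elem (grade b))) V (yd_braiding \<Gamma> V act \<delta>)"
proof -
  interpret vector_space s by (rule vs)
  have d: "grade b \<in> carrier \<Gamma>" if "b \<in> B" for b using grade[OF that] by (simp add: homogeneous_def)
  have "act (elem (grade i)) j \<in>
      span {a \<in> B. act (elem (grade a)) \<circ> act (elem (grade i)) = act (elem (grade i)) \<circ> act (elem (grade j))}"
    if i: "i \<in> B" and j: "j \<in> B" for i j
  proof -
    let ?w = "act (elem (grade i)) j" and ?h = "grade i \<otimes> grade j \<otimes> inv (grade i)"
    have "?w \<in> span B" using B(3) by simp
    then have "?w = (\<Sum>b\<in>B. scl V (representation B ?w b) b)"
      using B(1,2) sum_representation_eq[of B ?w B] by (simp add: V_eq)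
    from homogeneous_span[OF homogeneous_act[OF d[OF i] grade[OF j]] B(1) grade this]
    have "?w \<in> span {b \<in> B. grade b = ?h}" by (simp add: V_eq)
    also have "\<dots> \<subseteq> span {a \<in> B. act (elem (grade a)) \<circ> act (elem (grade i))
        = act (elem (grade i)) \<circ> act (elem (grade j))}"
    proof (intro span_mono subsetI CollectI conjI)
      fix a assume "a \<in> {b \<in> B. grade b = ?h}"
      then have a: "a \<in> B" and "grade a \<otimes> grade i = grade i \<otimes> grade j"
        using d i j by (auto simp: m_assoc)
      then show "act (elem (grade a)) \<circ> act (elem (grade i)) = act (elem (grade i)) \<circ> act (elem (grade j))"
        using d i j by (simp add: fun_eq_iff V_eq flip: act_mult)
      show "a \<in> B" by (rule a)
    qed
    finally show ?thesis .
  qed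
  moreover have "Vector_Spaces.linear s s (act (elem (grade b)))" if "b \<in> B" for b
    using linear_if_lin_map[OF vs V_eq lin_map_act[OF d[OF that]]] .
  moreover have "bij (act (elem (grade b)))" if "b \<in> B" for b
    using bij_betw_act[OF d[OF that]] by (simp add: V_eq)
  ultimately have "conjugating_family s B (\<lambda>b. b) (\<lambda>b. act (elem (grade b)))"
    using B by (intro conjugating_family.intro conjugating_family_axioms.intro vs) auto
  then show ?thesis
    using V_eq lin_map_yd_braiding yd_braiding_homogeneous[OF grade]
    by (intro group_type_braiding.intro group_type_braiding_axioms.intro) (auto simp: V_eq)
qed

end

text \<open>
  Elements of a finite group act with finite order. This allows their diagonalisation, and it
  makes every scalar that occurs as an eigenvalue a root of unity. In the noncommuting case the scalar
  \<open>q\<close> is an eigenvalue because \<open>-0 - 0 = 0\<close> modulo 3.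
\<close>

theorem yetter_drinfeld_dim3:
  fixes s :: "'k::{alg_closed_field, field_char_0} \<Rightarrow> 'v::ab_group_add \<Rightarrow> 'v"
  assumes vs: "vector_space s" and dim: "vector_space.dim s (UNIV :: 'v set) = 3"
    and V_eq: "V = \<lparr>carrier = UNIV, scl = s\<rparr>"
    and G: "group \<Gamma>" "finite (carrier \<Gamma>)" and yd: "yetter_drinfeld \<Gamma> V act \<delta>"
  shows "\<exists>x :: 3 \<Rightarrow> 'v. basis_family V UNIV x \<and>
    ((\<exists>q. (\<forall>i j. is_root_of_unity (q i j)) \<and>
        (\<forall>i j. yd_braiding \<Gamma> V act \<delta> (tens V V (x i) (x j)) =
               scl (V \<otimes>\<^sub>V V) (q i j) (tens V V (x j) (x i)))) \<or>
     (\<exists>q. is_root_of_unity q \<and>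
        (\<forall>i j. yd_braiding \<Gamma> V act \<delta> (tens V V (x i) (x j)) =
               scl (V \<otimes>\<^sub>V V) q (tens V V (x (- i - j)) (x i)))))"
proof -
  interpret vector_space s by (rule vs)
  interpret Y: yetter_drinfeld_module \<Gamma> V act \<delta>
    using G yd by (simp add: yetter_drinfeld_module_def yetter_drinfeld_module_axioms_def)
  obtain B grade where B: "independent B" "span B = UNIV" and grade: "\<And>b. b \<in> B \<Longrightarrow> Y.homogeneous (grade b) b"
    by (rule Y.homogeneous_basis[OF vs V_eq]) (rule that)
  have card: "card B = 3" using dim_eq_card[of B UNIV] B dim by simp
  then have finB: "finite B" by (intro card_ge_0_finite) simp
  interpret group_type_braiding s B "\<lambda>b. b" "\<lambda>b. act (Y.elem (grade b))" V "yd_braiding \<Gamma> V act \<delta>"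
    by (rule Y.group_type_braiding_yd[OF vs V_eq finB B grade])
  define N where "N = Coset.order \<Gamma>"
  have N: "N > 0" using G by (simp add: N_def Y.order_gt_0_iff_finite)
  have order: "act (Y.elem (grade b)) ^^ N = id" if "b \<in> B" for b
  proof
    fix v
    have d: "grade b \<in> carrier \<Gamma>" using grade[OF that] by (simp add: Y.homogeneous_def)
    then show "(act (Y.elem (grade b)) ^^ N) v = id v"
      by (simp add: Y.act_pow V_eq Y.act_one N_def Y.pow_order_eq_1)
  qed
  show ?thesis
  proof (cases "\<forall>i\<in>B. \<forall>j\<in>B. act (Y.elem (grade i)) \<circ> act (Y.elem (grade j))
      = act (Y.elem (grade j)) \<circ> act (Y.elem (grade i))")
    case True
    have card3: "card B = CARD(3)" using card by simp
    have N0: "(of_nat N :: 'k) \<noteq> 0" using N by simp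
    obtain x :: "3 \<Rightarrow> 'v" and q where "basis_family V UNIV x" "\<And>a b. q a b ^ N = 1"
      "\<And>a b. yd_braiding \<Gamma> V act \<delta> (tens V V (x a) (x b))
        = scl (V \<otimes>\<^sub>V V) (q a b) (tens V V (x b) (x a))"
      by (rule commuting_basis[OF card3 card_roots_of_unity[OF N] N0 True order]) (assumption, rule that)
    then show ?thesis using N unfolding is_root_of_unity_def by blast
  next
    case False
    obtain x :: "3 \<Rightarrow> 'v" and q where x: "basis_family V UNIV x"
      "\<And>a b. yd_braiding \<Gamma> V act \<delta> (tens V V (x a) (x b))
        = scl (V \<otimes>\<^sub>V V) q (tens V V (x (- a - b)) (x a))"
      "\<exists>i\<in>B. act (Y.elem (grade i)) (x 0) = s q (x 0)"
      by (rule noncommuting_basis[OF card False]) (rule that)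
    from x(3) obtain i where i: "i \<in> B" and eig: "act (Y.elem (grade i)) (x 0) = s q (x 0)" by blast
    interpret T: Vector_Spaces.linear s s "act (Y.elem (grade i))" by (rule lin[OF i])
    have "(act (Y.elem (grade i)) ^^ n) (x 0) = s (q ^ n) (x 0)" for n
      by (induction n) (simp_all add: T.scale eig mult.commute)
    from this[of N] have "s (q ^ N) (x 0) = s 1 (x 0)" by (simp add: order[OF i])
    moreover have "x 0 \<noteq> 0"
      using x(1) dependent_zero[of "range x"] by (auto simp: basis_family_def V_eq)
    ultimately have "q ^ N = 1" by (simp only: scale_cancel_right) simp
    then have "is_root_of_unity q" using N unfolding is_root_of_unity_def by blast
    with x(1,2) show ?thesis by blast
  qed
qed

theorem lemma4p2:
  fixes scale :: "'k::{alg_closed_field, field_char_0} \<Rightarrow> 'v::ab_group_add \<Rightarrow> 'v"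
    and V :: "('k, 'v) vec_space"
  assumes "vector_space scale"
    and "vector_space.dim scale (UNIV :: 'v set) = 3"
    and "V = \<lparr>carrier = UNIV, scl = scale\<rparr>"
  shows "(\<forall>c. braided_pair V c \<and> group_type V c \<longrightarrow>
            abelian_group_type V c \<or>
            (\<exists>q::'k. q \<noteq> 0 \<and> braided_iso V c V3_space (V3_braiding q))) \<and>
         (\<forall>(\<Gamma> :: 'g monoid) act \<delta>.
            group \<Gamma> \<and> finite (carrier \<Gamma>) \<and> yetter_drinfeld \<Gamma> V act \<delta> \<longrightarrow>
            (\<exists>x :: 3 \<Rightarrow> 'v. basis_family V UNIV x \<and>
              ((\<exists>q :: 3 \<Rightarrow> 3 \<Rightarrow> 'k. (\<forall>i j. is_root_of_unity (q i j)) \<and>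
                  (\<forall>i j. yd_braiding \<Gamma> V act \<delta> (tens V V (x i) (x j)) =
                         scl (V \<otimes>\<^sub>V V) (q i j) (tens V V (x j) (x i)))) \<or>
               (\<exists>q :: 'k. is_root_of_unity q \<and>
                  (\<forall>i j. yd_braiding \<Gamma> V act \<delta> (tens V V (x i) (x j)) =
                         scl (V \<otimes>\<^sub>V V) q (tens V V (x (- i - j)) (x i)))))))"
proof (intro conjI allI impI; elim conjE)
  fix c
  assume "braided_pair V c" "group_type V c"
  then show "abelian_group_type V c \<or> (\<exists>q::'k. q \<noteq> 0 \<and> braided_iso V c V3_space (V3_braiding q))"
    by (rule group_type_dim3[OF assms])
qed (rule yetter_drinfeld_dim3[OF assms])

end
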